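(* Let $p$ be an odd prime and let $\Delta_p=4p^4-4p^2-8p+9$, $\Theta_p=p^4-8p+8$. Define $$\lambda_{\pm}=p^2-p-\frac12\pm\frac12\sqrt{\Delta_p},\qquad \mu_{\pm}=\frac{p(p-2)\pm\sqrt{\Theta_p}}{2}.$$ Then the spectrum of the matrix $B_p=(p-1)H_p-D_p$ is $$\left\{\lambda_+,\lambda_-,\mu_+^{[p]},\mu_-^{[p]},\bigl(-p(p-1)\bigr)^{[p]},(p-1)^{[p(p-1)/2]},\bigl(-(p-1)\bigr)^{[(p+1)(p-2)/2]}\right\},$$ where the superscript $[m]$ denotes multiplicity $m$. Equivalently, $$\chi_{B_p}(\lambda)=(\lambda-\lambda_+)(\lambda-\lambda_-)(\lambda-\mu_+)^p(\lambda-\mu_-)^p(\lambda+p(p-1))^p(\lambda-(p-1))^{p(p-1)/2}(\lambda+(p-1))^{(p+1)(p-2)/2}.$$ Together with the factorization $\chi_{A_p}(\lambda)=\lambda^{p(p+1)(p-2)}(\lambda+1)^{(p+1)(p-2)}\chi_{B_p}(\lambda)$, this gives the complete spectrum of the adjacency matrix $A_p$ of $G_p$.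
   Context: For $n\ge2$, $\mathbb{L}_n=\{a+bi+cj+dk: a,b,c,d\in\mathbb{Z}/n\mathbb{Z}\}$ is the ring of Lipschitz quaternions modulo $n$, with the usual relations $i^2=j^2=k^2=-1$, $ij=k=-ji$, $jk=i=-kj$, $ki=j=-ik$ taken modulo $n$. A nonzero element $x$ of a ring is a zero divisor if $xy=0$ or $yx=0$ for some nonzero $y$. $G_n=\Gamma(\mathbb{L}_n)$ is the simple undirected graph whose vertices are the nonzero zero divisors of $\mathbb{L}_n$, distinct $x,y$ being adjacent iff $xy=0$ or $yx=0$; $A_n=A(G_n)$ is its adjacency matrix. (For odd primes $p$, $\mathbb{L}_p\cong M_2(\mathbb{F}_p)$.) $\mathcal{L}$ is the set of the $p+1$ one-dimensional subspaces of $\mathbb{F}_p^2$, and $\mathcal{T}=\mathcal{L}\times\mathcal{L}$. $H_p$ is the $\mathcal{T}\times\mathcal{T}$ $(0,1)$-matrix whose $((L,M),(L',M'))$ entry is $1$ iff $M=L'$ or $M'=L$; $D_p$ is the diagonal $\mathcal{T}\times\mathcal{T}$ matrix whose $((L,M),(L,M))$ entry is $1$ if $L=M$ and $0$ otherwise. $\chi_X(\lambda)=\det(\lambda I-X)$. Spectra are multisets of eigenvalues. *)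

theory Defs
  imports
    "HOL-Number_Theory.Residues"
    "Jordan_Normal_Form.Missing_VectorSpace"
    "Jordan_Normal_Form.Char_Poly"
    "Graph_Theory.Pair_Digraph"
begin

text \<open>
  The quadruple \<open>(a, b, c, d)\<close> of representatives in \<open>{0..<n}\<close> stands for
  \<open>a + b i + c j + d k\<close>.
\<close>

definition lipschitz_ring :: "nat \<Rightarrow> (int \<times> int \<times> int \<times> int) ring" where
  "lipschitz_ring n =
    \<lparr>carrier = {0..<int n} \<times> {0..<int n} \<times> {0..<int n} \<times> {0..<int n},
     monoid.mult = (\<lambda>(a, b, c, d) (a', b', c', d').
       ((a * a' - b * b' - c * c' - d * d') mod int n,
        (a * b' + b * a' + c * d' - d * c') mod int n,
        (a * c' - b * d' + c * a' + d * b') mod int n,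
        (a * d' + b * c' - c * b' + d * a') mod int n)),
     one = (1, 0, 0, 0),
     zero = (0, 0, 0, 0),
     add = (\<lambda>(a, b, c, d) (a', b', c', d').
       ((a + a') mod int n, (b + b') mod int n, (c + c') mod int n, (d + d') mod int n))\<rparr>"

definition zero_divisors :: "('a, 'm) ring_scheme \<Rightarrow> 'a set" where
  "zero_divisors R =
    {x \<in> carrier R. x \<noteq> \<zero>\<^bsub>R\<^esub> \<and>
       (\<exists>y \<in> carrier R. y \<noteq> \<zero>\<^bsub>R\<^esub> \<and> (x \<otimes>\<^bsub>R\<^esub> y = \<zero>\<^bsub>R\<^esub> \<or> y \<otimes>\<^bsub>R\<^esub> x = \<zero>\<^bsub>R\<^esub>))}"

text \<open>A simple undirected graph is represented by its symmetric, loop-free arc relation.\<close>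

definition zero_divisor_graph :: "('a, 'm) ring_scheme \<Rightarrow> 'a pair_pre_digraph" where
  "zero_divisor_graph R =
    \<lparr>pverts = zero_divisors R,
     parcs = {(x, y). x \<in> zero_divisors R \<and> y \<in> zero_divisors R \<and> x \<noteq> y \<and>
       (x \<otimes>\<^bsub>R\<^esub> y = \<zero>\<^bsub>R\<^esub> \<or> y \<otimes>\<^bsub>R\<^esub> x = \<zero>\<^bsub>R\<^esub>)}\<rparr>"

text \<open>
  The matrices below are indexed by finite sets. Such a matrix is represented relative to an
  enumeration \<open>xs\<close> of its index set, that is, a distinct list whose set of elements is the
  index set.
\<close>

definition indexed_mat :: "'i list \<Rightarrow> ('i \<Rightarrow> 'i \<Rightarrow> 'a) \<Rightarrow> 'a mat" where
  "indexed_mat xs f = mat (length xs) (length xs) (\<lambda>(i, j). f (xs ! i) (xs ! j))"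

definition adjacency_mat :: "'a pair_pre_digraph \<Rightarrow> 'a list \<Rightarrow> real mat" where
  "adjacency_mat G vs = indexed_mat vs (\<lambda>x y. if (x, y) \<in> parcs G then 1 else 0)"

text \<open>
  The vector space \<open>F\<^sub>p\<^sup>2\<close> over \<open>residue_ring p\<close>. The ring multiplication and unit that the
  record \<^typ>\<open>('a, 'b) module\<close> inherits play no role for modules.
\<close>

definition plane :: "nat \<Rightarrow> (int, int \<times> int) module" where
  "plane p =
    \<lparr>carrier = {0..<int p} \<times> {0..<int p},
     monoid.mult = undefined,
     one = undefined,
     zero = (0, 0),
     add = (\<lambda>(x, y) (x', y'). ((x + x') mod int p, (y + y') mod int p)),
     module.smult = (\<lambda>c (x, y). ((c * x) mod int p, (c * y) mod int p))\<rparr>"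

definition lines :: "nat \<Rightarrow> (int \<times> int) set set" where
  "lines p = {L. VectorSpace.subspace (residue_ring (int p)) L (plane p) \<and>
     vectorspace.dim (residue_ring (int p)) (plane p\<lparr>carrier := L\<rparr>) = 1}"

definition H_mat :: "('l \<times> 'l) list \<Rightarrow> real mat" where
  "H_mat ts = indexed_mat ts (\<lambda>(L, M) (L', M'). if M = L' \<or> M' = L then 1 else 0)"

definition D_mat :: "('l \<times> 'l) list \<Rightarrow> real mat" where
  "D_mat ts = indexed_mat ts (\<lambda>s t. if s = t \<and> fst s = snd s then 1 else 0)"

definition B_mat :: "nat \<Rightarrow> ('l \<times> 'l) list \<Rightarrow> real mat" where
  "B_mat p ts = (real p - 1) \<cdot>\<^sub>m H_mat ts - D_mat ts"

text \<open>Eigenvalues are counted with algebraic multiplicity.\<close>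

definition spectrum_mset :: "real mat \<Rightarrow> real multiset" where
  "spectrum_mset A = proots (char_poly A)"

definition Delta :: "nat \<Rightarrow> real" where
  "Delta p = 4 * real p ^ 4 - 4 * real p ^ 2 - 8 * real p + 9"

definition Theta :: "nat \<Rightarrow> real" where
  "Theta p = real p ^ 4 - 8 * real p + 8"

definition lambda_plus :: "nat \<Rightarrow> real" where
  "lambda_plus p = real p ^ 2 - real p - 1 / 2 + 1 / 2 * sqrt (Delta p)"

definition lambda_minus :: "nat \<Rightarrow> real" where
  "lambda_minus p = real p ^ 2 - real p - 1 / 2 - 1 / 2 * sqrt (Delta p)"

definition mu_plus :: "nat \<Rightarrow> real" where
  "mu_plus p = (real p * (real p - 2) + sqrt (Theta p)) / 2"

definition mu_minus :: "nat \<Rightarrow> real" where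
  "mu_minus p = (real p * (real p - 2) - sqrt (Theta p)) / 2"

lemma set_spectrum_mset:
  assumes "A \<in> carrier_mat n n"
  shows "set_mset (spectrum_mset A) = {e. eigenvalue A e}"
proof -
  have "char_poly A \<noteq> 0"
    using degree_monic_char_poly[OF assms] by auto
  then show ?thesis
    using eigenvalue_root_char_poly[OF assms] by (simp add: spectrum_mset_def)
qed

lemma vectorspace_plane:
  assumes "prime p"
  shows "vectorspace (residue_ring (int p)) (plane p)"
proof -
  interpret residues_prime p "residue_ring (int p)"
    by unfold_locales (use assms in \<open>auto simp: prime_gt_1_nat\<close>)
  have p: "int p > 1" using prime_gt_1_nat[OF assms] by simp
  have "abelian_group (plane p)"
  proof (rule abelian_groupI)
    fix x assume "x \<in> carrier (plane p)"
    then show "\<exists>y\<in>carrier (plane p). y \<oplus>\<^bsub>plane p\<^esub> x = \<zero>\<^bsub>plane p\<^esub>"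
      using p
      by (cases x)
        (intro bexI[of _ "((- fst x) mod int p, (- snd x) mod int p)"];
         auto simp: plane_def mod_simps)
  qed (use p in \<open>auto simp: plane_def mod_simps algebra_simps\<close>)
  moreover have "cring (residue_ring (int p))" by (rule cring)
  ultimately have "module (residue_ring (int p)) (plane p)"
    by (intro moduleI)
      (use p in \<open>auto simp: plane_def residue_ring_def mod_simps algebra_simps\<close>)
  then show ?thesis
    by (intro vectorspace.intro is_field)
qed

lemma finite_lines: "finite (lines p)"
proof (rule finite_subset)
  show "lines p \<subseteq> Pow (carrier (plane p))"
    by (auto simp: lines_def VectorSpace.subspace_def submodule_def)
  show "finite (Pow (carrier (plane p)))"
    by (simp add: plane_def)
qed

lemma pair_graph_zero_divisor_graph:
  "pair_graph (zero_divisor_graph (lipschitz_ring n))"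
proof -
  have fin: "finite (zero_divisors (lipschitz_ring n))"
    by (rule finite_subset[of _ "carrier (lipschitz_ring n)"])
      (auto simp: zero_divisors_def lipschitz_ring_def)
  have "finite (parcs (zero_divisor_graph (lipschitz_ring n)))"
    by (rule finite_subset[OF _ finite_cartesian_product[OF fin fin]])
      (auto simp: zero_divisor_graph_def)
  with fin show ?thesis
    by unfold_locales
      (auto simp: zero_divisor_graph_def symmetric_def sym_def)
qed

end

theory Submission
  imports Defs
begin

text \<open>
  An odd prime \<open>p\<close> admits integers with \<open>a\<^sup>2 + b\<^sup>2 = -1\<close> modulo \<open>p\<close>, which identifies the
  quaternions modulo \<open>p\<close> with the two-by-two matrices over the field with \<open>p\<close> elements. Zero divisors
  become matrices \<open>c u v\<^sup>T\<close> of rank one. Such a matrix is determined, up to one of \<open>p - 1\<close> scalars, by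
  its kernel \<open>L\<close> and its image \<open>M\<close>, and \<open>x y = 0\<close> holds iff the image of \<open>y\<close> is the kernel of \<open>x\<close>
  (\<open>zero_divisor_types\<close>). So adjacency depends only on the types \<open>(L, M)\<close>: the adjacency matrix arises
  from \<open>H\<close> by taking \<open>p - 1\<close> copies of each index and deleting the loops, which occur where \<open>L = M\<close>.
  The lemma \<open>char_poly_blow_up\<close> turns this into the factorisation over the characteristic polynomial of
  \<open>B\<close>.

  For \<open>B\<close> itself only the number \<open>p + 1\<close> of lines matters. The entry of \<open>H\<close> at \<open>((L, M), (L', M'))\<close> is
  \<open>[M = L'] + [M' = L]\<close>, a matrix of rank at most \<open>2 (p + 1)\<close>, minus the permutation matrix of
  \<open>(L, M) \<mapsto> (M, L)\<close>. The determinant of \<open>l - B\<close> is therefore found by removing low-rank terms with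
  \<open>det (N - X Y) = det N \<cdot> det (1 - Y N\<^sup>-\<^sup>1 X)\<close> (\<open>det_indexed_mat_low_rank_update\<close>). The swap is itself removed
  this way, over the unordered pairs of lines, and yields powers of \<open>l - (p - 1)\<close> and \<open>l + (p - 1)\<close>. The
  low-rank term splits into a part symmetric under the swap and an antisymmetric one, both indexed by
  lines, and for each of them the small matrix \<open>1 - Y N\<^sup>-\<^sup>1 X\<close> is a scalar matrix plus a constant one.
  In the symmetric case the scalar, to the power \<open>p\<close>, gives \<open>\<mu>\<^sub>\<plusminus>\<close> and the eigenvalue on constant vectors
  gives \<open>\<lambda>\<^sub>\<plusminus>\<close>; in the antisymmetric case the scalar gives \<open>- p (p - 1)\<close> and the constant vectors
  give nothing (\<open>det_composability\<close>). The denominators lower the exponents of \<open>l - (p - 1)\<close> and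
  \<open>l + (p - 1)\<close> to the multiplicities claimed (\<open>spectral_factor_identity\<close>).
\<close>

section \<open>Determinants of matrices indexed by lists\<close>

text \<open>
  The rectangular companion of \<^const>\<open>indexed_mat\<close>, needed for the factors of a low-rank matrix.
\<close>

definition rect_mat :: "'i list \<Rightarrow> 'j list \<Rightarrow> ('i \<Rightarrow> 'j \<Rightarrow> 'a) \<Rightarrow> 'a mat" where
  "rect_mat xs ys f = mat (length xs) (length ys) (\<lambda>(i, j). f (xs ! i) (ys ! j))"

lemma indexed_mat_eq_rect_mat: "indexed_mat xs f = rect_mat xs xs f"
  by (simp add: indexed_mat_def rect_mat_def)

lemma rect_mat_carrier [simp]: "rect_mat xs ys f \<in> carrier_mat (length xs) (length ys)"
  by (simp add: rect_mat_def)

lemmas rect_mat_neutral =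
  right_mult_one_mat[OF rect_mat_carrier] left_mult_one_mat[OF rect_mat_carrier]
  right_mult_zero_mat[OF rect_mat_carrier] left_mult_zero_mat[OF rect_mat_carrier]
  right_add_zero_mat[OF rect_mat_carrier] left_add_zero_mat[OF rect_mat_carrier]

lemma rect_mat_cong:
  assumes "\<And>x y. x \<in> set xs \<Longrightarrow> y \<in> set ys \<Longrightarrow> f x y = g x y"
  shows "rect_mat xs ys f = rect_mat xs ys g"
  unfolding rect_mat_def by (rule eq_matI) (auto intro: assms)

lemma rect_mat_mult:
  fixes f :: "'i \<Rightarrow> 'j \<Rightarrow> 'a :: comm_semiring_0"
  assumes "distinct ys"
  shows "rect_mat xs ys f * rect_mat ys zs g = rect_mat xs zs (\<lambda>x z. \<Sum>y\<in>set ys. f x y * g y z)"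
proof (rule eq_matI, goal_cases)
  case (1 i j)
  have "(\<Sum>y\<in>set ys. f (xs ! i) y * g y (zs ! j)) =
      (\<Sum>k\<in>{0..<length ys}. f (xs ! i) (ys ! k) * g (ys ! k) (zs ! j))"
    by (rule sum.reindex_bij_betw[symmetric])
      (use assms in \<open>auto simp: atLeast0LessThan intro!: bij_betw_nth\<close>)
  then show ?case
    using 1 by (simp add: rect_mat_def scalar_prod_def)
qed (auto simp: rect_mat_def)

lemma rect_mat_add:
  "rect_mat xs ys f + rect_mat xs ys g = rect_mat xs ys (\<lambda>x y. f x y + g x y)"
  unfolding rect_mat_def by (rule eq_matI) auto

lemma rect_mat_identity:
  assumes "distinct xs"
  shows "rect_mat xs xs (\<lambda>x y. if x = y then 1 else 0) = 1\<^sub>m (length xs)"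
  unfolding rect_mat_def by (rule eq_matI) (auto simp: nth_eq_iff_index_eq[OF assms])

lemma det_indexed_mat_diagonal:
  fixes d :: "'i \<Rightarrow> 'a :: comm_ring_1"
  assumes "distinct xs"
  shows "det (indexed_mat xs (\<lambda>s t. if s = t then d s else 0)) = (\<Prod>s\<in>set xs. d s)"
proof -
  let ?A = "indexed_mat xs (\<lambda>s t. if s = t then d s else 0)"
  have "upper_triangular ?A"
    by (auto simp: upper_triangular_def indexed_mat_def nth_eq_iff_index_eq[OF assms])
  then have "det ?A = prod_list (diag_mat ?A)"
    by (rule det_upper_triangular[of _ "length xs"]) (simp add: indexed_mat_def)
  also have "diag_mat ?A = map d xs"
    by (rule nth_equalityI) (auto simp: diag_mat_def indexed_mat_def)
  also have "prod_list (map d xs) = (\<Prod>s\<in>set xs. d s)"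
    using assms by (simp add: prod.distinct_set_conv_list)
  finally show ?thesis .
qed

text \<open>
  Both sides are the determinant of the block matrix with rows \<open>(N, X)\<close> and \<open>(Y, 1)\<close>, which splits
  into block triangular factors in two ways: clearing \<open>Y\<close> from the right leaves \<open>N - X Y\<close>, and
  splitting off \<open>N\<close> leaves \<open>1 - Y W\<close>. Here \<open>W\<close> stands for \<open>N\<^sup>-\<^sup>1 X\<close>, but it is easier to exhibit and
  check a solution of \<open>N W = X\<close> than to compute an inverse.
\<close>

lemma det_indexed_mat_low_rank_update:
  fixes N :: "'i \<Rightarrow> 'i \<Rightarrow> 'a :: idom"
  assumes xs: "distinct xs" and ys: "distinct ys"
    and NW: "\<And>s z. s \<in> set xs \<Longrightarrow> z \<in> set ys \<Longrightarrow> (\<Sum>t\<in>set xs. N s t * W t z) = X s z"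
  shows "det (indexed_mat xs (\<lambda>s t. N s t - (\<Sum>z\<in>set ys. X s z * Y z t))) =
    det (indexed_mat xs N) *
    det (indexed_mat ys (\<lambda>z z'. (if z = z' then 1 else 0) - (\<Sum>s\<in>set xs. Y z s * W s z')))"
proof -
  let ?n = "length xs" and ?m = "length ys"
  let ?N = "rect_mat xs xs N" and ?X = "rect_mat xs ys X"
    and ?Y = "rect_mat ys xs Y" and ?W = "rect_mat xs ys W"
  let ?S = "rect_mat xs xs (\<lambda>s t. N s t - (\<Sum>z\<in>set ys. X s z * Y z t))"
  let ?T = "rect_mat ys ys (\<lambda>z z'. (if z = z' then 1 else 0) - (\<Sum>s\<in>set xs. Y z s * W s z'))"
  let ?M = "four_block_mat ?N ?X ?Y (1\<^sub>m ?m)"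
  have "?M = four_block_mat ?S ?X (0\<^sub>m ?m ?n) (1\<^sub>m ?m) *
      four_block_mat (1\<^sub>m ?n) (0\<^sub>m ?n ?m) ?Y (1\<^sub>m ?m)"
    by (subst mult_four_block_mat[of _ ?n ?n _ ?m _ ?m _ _ ?n _ ?m])
      (simp_all add: rect_mat_mult ys rect_mat_add rect_mat_neutral)
  then have 1: "det ?M = det ?S"
    by (simp add: det_mult[of _ "?n + ?m"]
        det_four_block_mat_lower_left_zero[where n = ?n and m = ?m]
        det_four_block_mat_upper_right_zero[where n = ?n and m = ?m])
  have X: "?X = rect_mat xs ys (\<lambda>s z. \<Sum>t\<in>set xs. N s t * W t z)"
    by (rule rect_mat_cong) (simp add: NW)
  have "?M = four_block_mat ?N (0\<^sub>m ?n ?m) ?Y ?T *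
      four_block_mat (1\<^sub>m ?n) ?W (0\<^sub>m ?m ?n) (1\<^sub>m ?m)"
    by (subst mult_four_block_mat[of _ ?n ?n _ ?m _ ?m _ _ ?n _ ?m])
      (simp_all add: rect_mat_mult xs rect_mat_add X rect_mat_identity ys
        rect_mat_neutral)
  then have 2: "det ?M = det ?N * det ?T"
    by (simp add: det_mult[of _ "?n + ?m"]
        det_four_block_mat_lower_left_zero[where n = ?n and m = ?m]
        det_four_block_mat_upper_right_zero[where n = ?n and m = ?m])
  show ?thesis
    unfolding indexed_mat_eq_rect_mat 1[symmetric] 2[symmetric] ..
qed

lemma indexed_mat_cong:
  assumes "\<And>x y. x \<in> set xs \<Longrightarrow> y \<in> set xs \<Longrightarrow> f x y = g x y"
  shows "indexed_mat xs f = indexed_mat xs g"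
  unfolding indexed_mat_eq_rect_mat by (rule rect_mat_cong) (rule assms)

text \<open>
  The constant matrix has rank one, so this is a low-rank update indexed by a single point.
\<close>

lemma det_indexed_mat_scalar_plus_constant:
  fixes a b :: "'a :: field"
  assumes "distinct xs" and "xs \<noteq> []" and "a \<noteq> 0"
  shows "det (indexed_mat xs (\<lambda>s t. (if s = t then a else 0) + b)) =
    a ^ (length xs - 1) * (a + of_nat (length xs) * b)"
proof -
  obtain n where n: "length xs = Suc n"
    using assms(2) by (cases xs) auto
  have eq: "indexed_mat xs (\<lambda>s t. (if s = t then a else 0) + b) =
      indexed_mat xs (\<lambda>s t. (if s = t then a else 0) - (\<Sum>z\<in>set [()]. (- b) * 1))"
    by simp
  have "det (indexed_mat xs (\<lambda>s t. (if s = t then a else 0) + b)) =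
      det (indexed_mat xs (\<lambda>s t. if s = t then a else 0)) *
      det (indexed_mat [()] (\<lambda>z z'. (if z = z' then 1 else 0) - (\<Sum>s\<in>set xs. 1 * (- b / a))))"
    unfolding eq
    by (rule det_indexed_mat_low_rank_update[where X = "\<lambda>_ _. - b" and Y = "\<lambda>_ _. 1" and W = "\<lambda>_ _. - b / a"])
      (use assms in \<open>auto simp: if_distrib[of "\<lambda>x. x * _"] if_distrib[of "\<lambda>x. x / _"] sum_negf cong: if_cong\<close>)
  also have "det (indexed_mat xs (\<lambda>s t. if s = t then a else 0)) = a ^ length xs"
    using assms(1) by (simp add: det_indexed_mat_diagonal distinct_card)
  also have "det (indexed_mat [()] (\<lambda>z z'. (if z = z' then 1 else 0) - (\<Sum>s\<in>set xs. 1 * (- b / a)))) =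
      1 + of_nat (length xs) * b / a"
    using det_indexed_mat_diagonal[of "[()]" "\<lambda>_. 1 + of_nat (length xs) * b / a"] assms(1)
    by (simp add: distinct_card)
  also have "a ^ length xs * (1 + of_nat (length xs) * b / a) =
      a ^ n * (a * (1 + of_nat (length xs) * b / a))"
    unfolding n power_Suc2 mult.assoc ..
  also have "a * (1 + of_nat (length xs) * b / a) = a + of_nat (length xs) * b"
    using assms(3) by (simp add: distrib_left)
  finally show ?thesis
    by (simp add: n)
qed

lemma poly_char_poly_indexed_mat:
  fixes f :: "'i \<Rightarrow> 'i \<Rightarrow> 'a :: field"
  assumes "distinct xs"
  shows "poly (char_poly (indexed_mat xs f)) l =
    det (indexed_mat xs (\<lambda>s t. (if s = t then l else 0) - f s t))"
proof -
  have "- char_matrix (indexed_mat xs f) l =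
      indexed_mat xs (\<lambda>s t. (if s = t then l else 0) - f s t)"
    by (rule eq_matI)
      (auto simp: char_matrix_def indexed_mat_def nth_eq_iff_index_eq[OF assms])
  then show ?thesis
    by (subst char_poly_matrix[of _ "length xs"]) (auto simp: indexed_mat_def)
qed

lemma poly_eq_if_eq_outside_finite:
  fixes f g :: "'a :: {idom, ring_char_0} poly"
  assumes "finite S" and "\<And>x. x \<notin> S \<Longrightarrow> poly f x = poly g x"
  shows "f = g"
proof (rule ccontr)
  assume "f \<noteq> g"
  then have "finite {x. poly (f - g) x = 0}"
    by (intro poly_roots_finite) auto
  moreover have "- S \<subseteq> {x. poly (f - g) x = 0}"
    using assms(2) by auto
  ultimately have "finite (- S)"
    using finite_subset by blast
  then show False
    using assms(1) infinite_UNIV_char_0 by (metis finite_compl)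
qed

text \<open>
  Replacing every index \<open>t\<close> by \<open>m + 1\<close> copies gives a matrix that factors through the index set \<open>ts\<close>,
  up to the diagonal correction \<open>d\<close>. The low-rank update over \<open>ts\<close> therefore applies to the diagonal
  matrix with entries \<open>l + d (type x)\<close>; each fibre contributes \<open>m + 1\<close> equal factors to its determinant,
  one of which is absorbed into the matrix over \<open>ts\<close>. The vectors that sum to zero on one fibre
  account for the remaining \<open>m\<close> factors. The values \<open>l = - d t\<close>, at which the
  diagonal matrix is singular, are finitely many and so do not matter for an identity of polynomials.
\<close>

lemma char_poly_blow_up:
  fixes K :: "'t \<Rightarrow> 't \<Rightarrow> 'a :: field_char_0"
  assumes vs: "distinct vs" and ts: "distinct ts"
    and type: "\<And>x. x \<in> set vs \<Longrightarrow> type x \<in> set ts"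
    and fibre: "\<And>t. t \<in> set ts \<Longrightarrow> card {x \<in> set vs. type x = t} = Suc m"
  shows "char_poly (indexed_mat vs (\<lambda>x y. K (type x) (type y) - (if x = y then d (type x) else 0))) =
    (\<Prod>t\<in>set ts. [:d t, 1:] ^ m) *
    char_poly (indexed_mat ts (\<lambda>s t. of_nat (Suc m) * K s t - (if s = t then d s else 0)))"
    (is "?A = _ * ?B")
proof (rule poly_eq_if_eq_outside_finite)
  let ?S = "(\<lambda>t. - d t) ` set ts"
  show "finite ?S" by simp
  fix l assume "l \<notin> ?S"
  then have nz: "l + d t \<noteq> 0" if "t \<in> set ts" for t
    using that by (auto simp: add_eq_0_iff2)
  let ?W = "\<lambda>x t. if type x = t then 1 / (l + d t) else 0"
  let ?C = "\<lambda>s t. (if s = t then 1 else 0) - of_nat (Suc m) * K s t / (l + d t)"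
  have fib_sum: "(\<Sum>x\<in>set vs. if type x = t then g x else 0) = of_nat (Suc m) * a"
    if "t \<in> set ts" "\<And>x. type x = t \<Longrightarrow> g x = a" for g :: "_ \<Rightarrow> 'a" and a t
  proof -
    have "(\<Sum>x\<in>set vs. if type x = t then g x else 0) = (\<Sum>x | x \<in> set vs \<and> type x = t. a)"
      by (subst sum.inter_filter[symmetric]) (auto simp: that intro!: sum.cong)
    then show ?thesis
      using fibre[OF that(1)] by simp
  qed
  have "poly ?A l = det (indexed_mat vs (\<lambda>x y. (if x = y then l + d (type x) else 0) -
      (\<Sum>t\<in>set ts. (if type x = t then 1 else 0) * K t (type y))))"
    unfolding poly_char_poly_indexed_mat[OF vs]
    by (intro arg_cong[where f = det] indexed_mat_cong)
      (auto simp: type if_distrib[of "\<lambda>x. x * _"] cong: if_cong)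
  also have "\<dots> = det (indexed_mat vs (\<lambda>x y. if x = y then l + d (type x) else 0)) *
      det (indexed_mat ts (\<lambda>s t. (if s = t then 1 else 0) - (\<Sum>x\<in>set vs. K s (type x) * ?W x t)))"
    by (rule det_indexed_mat_low_rank_update[OF vs ts])
      (use type nz in \<open>auto simp: if_distrib[of "\<lambda>x. x * _"] cong: if_cong\<close>)
  also have "det (indexed_mat vs (\<lambda>x y. if x = y then l + d (type x) else 0)) =
      (\<Prod>x\<in>set vs. l + d (type x))"
    by (rule det_indexed_mat_diagonal[OF vs])
  also have "\<dots> = (\<Prod>t\<in>set ts. \<Prod>x | x \<in> set vs \<and> type x = t. l + d (type x))"
    by (rule prod.group[symmetric]) (use type in auto)
  also have "\<dots> = (\<Prod>t\<in>set ts. (l + d t) ^ Suc m)"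
    by (rule prod.cong) (auto simp: fibre)
  also have "indexed_mat ts (\<lambda>s t. (if s = t then 1 else 0) - (\<Sum>x\<in>set vs. K s (type x) * ?W x t)) =
      indexed_mat ts ?C"
  proof (rule indexed_mat_cong)
    fix s t assume t: "t \<in> set ts"
    have "(\<Sum>x\<in>set vs. K s (type x) * ?W x t) =
        (\<Sum>x\<in>set vs. if type x = t then K s (type x) / (l + d t) else 0)"
      by (rule sum.cong) auto
    also have "\<dots> = of_nat (Suc m) * (K s t / (l + d t))"
      by (rule fib_sum[OF t]) auto
    finally show "(if s = t then 1 else 0) - (\<Sum>x\<in>set vs. K s (type x) * ?W x t) = ?C s t"
      by simp
  qed
  also have "(\<Prod>t\<in>set ts. (l + d t) ^ Suc m) =
      (\<Prod>t\<in>set ts. (l + d t) ^ m) * (\<Prod>t\<in>set ts. l + d t)"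
    by (simp add: prod.distrib mult.commute)
  \<comment> \<open>The spare factor of each fibre clears the denominators of \<open>?C\<close>, column by column.\<close>
  also have "\<dots> * det (indexed_mat ts ?C) = (\<Prod>t\<in>set ts. (l + d t) ^ m) *
      (det (indexed_mat ts ?C) * det (indexed_mat ts (\<lambda>s t. if s = t then l + d s else 0)))"
    by (simp add: det_indexed_mat_diagonal[OF ts])
  also have "det (indexed_mat ts ?C) * det (indexed_mat ts (\<lambda>s t. if s = t then l + d s else 0)) =
      det (indexed_mat ts ?C * indexed_mat ts (\<lambda>s t. if s = t then l + d s else 0))"
    by (rule det_mult[of _ "length ts", symmetric]) (auto simp: indexed_mat_eq_rect_mat)
  also have "indexed_mat ts ?C * indexed_mat ts (\<lambda>s t. if s = t then l + d s else 0) =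
      indexed_mat ts (\<lambda>s t. (if s = t then l else 0) -
        (of_nat (Suc m) * K s t - (if s = t then d s else 0)))"
    unfolding indexed_mat_eq_rect_mat rect_mat_mult[OF ts]
  proof (rule rect_mat_cong)
    fix s t assume t: "t \<in> set ts"
    have "(\<Sum>r\<in>set ts. ?C s r * (if r = t then l + d r else 0)) =
        (\<Sum>r\<in>set ts. if r = t then ?C s r * (l + d r) else 0)"
      by (rule sum.cong) auto
    also have "\<dots> = ?C s t * (l + d t)"
      using t by simp
    also have "\<dots> = (if s = t then l + d t else 0) - of_nat (Suc m) * K s t"
      using nz[OF t] by (simp add: left_diff_distrib)
    finally show "(\<Sum>r\<in>set ts. ?C s r * (if r = t then l + d r else 0)) =
        (if s = t then l else 0) - (of_nat (Suc m) * K s t - (if s = t then d s else 0))"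
      by simp
  qed
  also have "det \<dots> = poly ?B l"
    by (rule poly_char_poly_indexed_mat[OF ts, symmetric])
  finally show "poly ?A l = poly ((\<Prod>t\<in>set ts. [:d t, 1:] ^ m) * ?B) l"
    by (simp add: poly_prod add.commute)
qed

section \<open>The determinant behind the matrix of types\<close>

text \<open>
  The entry of \<open>H\<close> at \<open>((L, M), (L', M'))\<close> is \<open>[M = L'] + [M' = L] - [(L', M') = (M, L)]\<close>, because both
  conditions hold exactly when the two pairs are swaps of each other. With \<open>c = p - 1\<close>, this is the
  part of \<open>l - c H + D\<close> that is left when the first two terms are dropped; these have low rank.
\<close>

definition swap_kernel :: "real \<Rightarrow> real \<Rightarrow> 'l \<times> 'l \<Rightarrow> 'l \<times> 'l \<Rightarrow> real" where
  "swap_kernel l c s t =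
    (if s = t then l else 0) + (if s = t \<and> fst s = snd s then 1 else 0) + (if t = prod.swap s then c else 0)"

lemma sum_swap_kernel:
  assumes "finite \<Lambda>" and "s \<in> \<Lambda> \<times> \<Lambda>"
  shows "(\<Sum>t\<in>\<Lambda> \<times> \<Lambda>. swap_kernel l c s t * g t) =
    (l + (if fst s = snd s then 1 else 0)) * g s + c * g (prod.swap s)"
proof -
  have "swap_kernel l c s t * g t =
      (if t = s then (l + (if fst s = snd s then 1 else 0)) * g s else 0) +
      (if t = prod.swap s then c * g (prod.swap s) else 0)" for t
    by (auto simp: swap_kernel_def algebra_simps)
  then show ?thesis
    using assms by (auto simp: sum.distrib)
qed

text \<open>
  Off the diagonal of \<open>\<Lambda> \<times> \<Lambda>\<close>, identity plus swap is \<open>E E\<^sup>T\<close>, where \<open>E\<close> is the incidence matrix of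
  ordered against unordered pairs. So the matrix is a diagonal one plus \<open>c E E\<^sup>T\<close>, and since
  \<open>E\<^sup>T E = 2\<close> the update indexed by the two-element subsets of \<open>\<Lambda>\<close> is a scalar matrix.
\<close>

lemma det_swap_kernel:
  assumes ts: "distinct ts" "set ts = \<Lambda> \<times> \<Lambda>" and fin: "finite \<Lambda>" and "l \<noteq> c"
  shows "det (indexed_mat ts (swap_kernel l c)) =
    (l + c + 1) ^ card \<Lambda> * ((l - c) * (l + c)) ^ (card \<Lambda> choose 2)"
proof -
  let ?E = "{e. e \<subseteq> \<Lambda> \<and> card e = 2}" and ?q = "card \<Lambda>"
  have finE: "finite ?E"
    using fin by simp
  obtain es where es: "distinct es" "set es = ?E"
    using finite_distinct_list[OF finE] by blast
  have cardE: "card ?E = ?q choose 2"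
    by (rule n_subsets[OF fin])
  let ?d = "\<lambda>s. if fst s = snd s then l + c + 1 else l - c"
  let ?I = "\<lambda>s e. if {fst s, snd s} = e then 1 else 0 :: real"
  have off_diagonal: "e \<in> ?E \<Longrightarrow> {fst s, snd s} = e \<Longrightarrow> fst s \<noteq> snd s" for e and s :: "'a \<times> 'a"
    by auto
  have sum_edges: "(\<Sum>e\<in>?E. - c * ?I s e * ?I t e) =
      (if fst s \<noteq> snd s \<and> (t = s \<or> t = prod.swap s) then - c else 0)"
    if "s \<in> \<Lambda> \<times> \<Lambda>" for s t
  proof -
    have "(\<Sum>e\<in>?E. - c * ?I s e * ?I t e) =
        (\<Sum>e\<in>?E. if {fst s, snd s} = e then - c * ?I t e else 0)"
      by (rule sum.cong) auto
    also have "\<dots> = (if {fst s, snd s} \<in> ?E then - c * ?I t {fst s, snd s} else 0)"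
      using finE by simp
    also have "{fst s, snd s} \<in> ?E \<longleftrightarrow> fst s \<noteq> snd s"
      using that by (auto simp: card_insert_if)
    also have "(if fst s \<noteq> snd s then - c * ?I t {fst s, snd s} else 0) =
        (if fst s \<noteq> snd s \<and> (t = s \<or> t = prod.swap s) then - c else 0)"
      by (cases s; cases t) (auto simp: doubleton_eq_iff)
    finally show ?thesis .
  qed
  have sum_arcs: "(\<Sum>s\<in>\<Lambda> \<times> \<Lambda>. ?I s e * (- c * ?I s e' / (l - c))) =
      (if e = e' then - (2 * c / (l - c)) else 0)" if edge: "e \<in> ?E" for e e'
  proof -
    obtain x y where e: "e = {x, y}" "x \<noteq> y"
      using edge unfolding card_2_iff by blast
    with edge have xy: "x \<in> \<Lambda>" "y \<in> \<Lambda>"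
      by auto
    define k where "k = (if e = e' then - c / (l - c) else 0)"
    have "(\<Sum>s\<in>\<Lambda> \<times> \<Lambda>. ?I s e * (- c * ?I s e' / (l - c))) =
        (\<Sum>s\<in>\<Lambda> \<times> \<Lambda>. if {fst s, snd s} = e then k else 0)"
      by (rule sum.cong) (auto simp: k_def)
    also have "\<dots> = (\<Sum>s\<in>\<Lambda> \<times> \<Lambda>. (if (x, y) = s then k else 0) + (if (y, x) = s then k else 0))"
      unfolding e(1) using e(2) by (intro sum.cong refl) (auto simp: doubleton_eq_iff)
    also have "\<dots> = 2 * k"
      using xy fin by (simp add: sum.distrib)
    also have "\<dots> = (if e = e' then - (2 * c / (l - c)) else 0)"
      by (simp add: k_def)
    finally show ?thesis .
  qed
  have "det (indexed_mat ts (swap_kernel l c)) =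
      det (indexed_mat ts (\<lambda>s t. (if s = t then ?d s else 0) - (\<Sum>e\<in>set es. - c * ?I s e * ?I t e)))"
    unfolding es(2)
    by (rule arg_cong[where f = det], rule indexed_mat_cong)
      (use sum_edges in \<open>auto simp: ts(2) swap_kernel_def prod_eq_iff\<close>)
  also have "\<dots> = det (indexed_mat ts (\<lambda>s t. if s = t then ?d s else 0)) *
      det (indexed_mat es (\<lambda>e e'. (if e = e' then 1 else 0) -
        (\<Sum>s\<in>set ts. ?I s e * (- c * ?I s e' / (l - c)))))"
  proof (rule det_indexed_mat_low_rank_update[OF ts(1) es(1)])
    fix s e assume s: "s \<in> set ts" and "e \<in> set es"
    then have e: "e \<in> ?E"
      by (simp add: es(2))
    have "(\<Sum>t\<in>set ts. (if s = t then ?d s else 0) * (- c * ?I t e / (l - c))) =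
        (\<Sum>t\<in>set ts. if s = t then ?d s * (- c * ?I s e / (l - c)) else 0)"
      by (rule sum.cong) auto
    also have "\<dots> = ?d s * (- c * ?I s e / (l - c))"
      using s by simp
    also have "\<dots> = - c * ?I s e"
      using off_diagonal[OF e, of s] assms(4) by simp
    finally show "(\<Sum>t\<in>set ts. (if s = t then ?d s else 0) * (- c * ?I t e / (l - c))) = - c * ?I s e" .
  qed
  also have "det (indexed_mat ts (\<lambda>s t. if s = t then ?d s else 0)) = (\<Prod>s\<in>\<Lambda> \<times> \<Lambda>. ?d s)"
    by (simp add: det_indexed_mat_diagonal[OF ts(1)] ts(2))
  also have "\<dots> = (\<Prod>s\<in>(\<lambda>x. (x, x)) ` \<Lambda>. ?d s) * (\<Prod>s\<in>\<Lambda> \<times> \<Lambda> - (\<lambda>x. (x, x)) ` \<Lambda>. ?d s)"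
    by (subst prod.subset_diff[of "(\<lambda>x. (x, x)) ` \<Lambda>"]) (use fin in \<open>auto simp: mult.commute\<close>)
  also have "(\<Prod>s\<in>(\<lambda>x. (x, x)) ` \<Lambda>. ?d s) = (l + c + 1) ^ ?q"
    by (subst prod.reindex) (auto simp: inj_on_def)
  also have "(\<Prod>s\<in>\<Lambda> \<times> \<Lambda> - (\<lambda>x. (x, x)) ` \<Lambda>. ?d s) =
      (\<Prod>s\<in>\<Lambda> \<times> \<Lambda> - (\<lambda>x. (x, x)) ` \<Lambda>. l - c)"
    by (rule prod.cong) auto
  also have "\<dots> = (l - c) ^ (?q * ?q - ?q)"
    using fin by (simp add: card_Diff_subset image_subset_iff card_image inj_on_def card_cartesian_product)
  also have "?q * ?q - ?q = 2 * (?q choose 2)"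
    by (simp add: choose_two algebra_simps diff_mult_distrib2)
  also have "indexed_mat es (\<lambda>e e'. (if e = e' then 1 else 0) -
        (\<Sum>s\<in>set ts. ?I s e * (- c * ?I s e' / (l - c)))) =
      indexed_mat es (\<lambda>e e'. if e = e' then (l + c) / (l - c) else 0)"
    unfolding ts(2)
  proof (rule indexed_mat_cong)
    fix e e' assume "e \<in> set es"
    then have e: "e \<in> ?E"
      by (simp add: es(2))
    have "l - c + 2 * c = l + c"
      by simp
    then have "1 - - (2 * c / (l - c)) = (l + c) / (l - c)"
      using add_divide_distrib[of "l - c" "2 * c" "l - c"] assms(4) by (simp add: add.commute)
    then show "(if e = e' then 1 else 0) - (\<Sum>s\<in>\<Lambda> \<times> \<Lambda>. ?I s e * (- c * ?I s e' / (l - c))) =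
        (if e = e' then (l + c) / (l - c) else 0)"
      unfolding sum_arcs[OF e] by simp
  qed
  also have "det \<dots> = ((l + c) / (l - c)) ^ (?q choose 2)"
    by (simp add: det_indexed_mat_diagonal[OF es(1)] es(2) cardE)
  finally show ?thesis
    using assms(4) by (simp add: power_mult power2_eq_square power_mult_distrib power_divide)
qed

text \<open>
  The vectors \<open>(L, M) \<mapsto> [L = z] + \<epsilon> [M = z]\<close> for \<open>\<epsilon> = 1\<close> and \<open>\<epsilon> = -1\<close> split the low-rank part of \<open>H\<close> into
  its symmetric and antisymmetric halves under swapping.
\<close>

definition incidence :: "real \<Rightarrow> 'l \<times> 'l \<Rightarrow> 'l \<Rightarrow> real" where
  "incidence \<epsilon> s z = (if fst s = z then 1 else 0) + (if snd s = z then \<epsilon> else 0)"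

text \<open>
  For \<open>\<epsilon> = 1\<close> and \<open>\<eta> = -1\<close> the sum is zero: the symmetric and the antisymmetric half are
  orthogonal, so the two updates do not interact.
\<close>

lemma sum_incidence:
  assumes "finite \<Lambda>" and "z \<in> \<Lambda>" and "z' \<in> \<Lambda>"
  shows "(\<Sum>s\<in>\<Lambda> \<times> \<Lambda>. incidence \<epsilon> s z * incidence \<eta> s z') =
    (if z = z' then (1 + \<epsilon> * \<eta>) * card \<Lambda> else 0) + \<epsilon> + \<eta>"
proof -
  have "incidence \<epsilon> (x, y) z * incidence \<eta> (x, y) z' =
      (if x = z then (if z = z' then 1 else 0) + (if y = z' then \<eta> else 0) else 0) +
      (if y = z then (if z = z' then \<epsilon> * \<eta> else 0) + (if x = z' then \<epsilon> else 0) else 0)" for x y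
    by (auto simp: incidence_def algebra_simps)
  then have "(\<Sum>s\<in>\<Lambda> \<times> \<Lambda>. incidence \<epsilon> s z * incidence \<eta> s z') =
      (\<Sum>x\<in>\<Lambda>. \<Sum>y\<in>\<Lambda>. if x = z then (if z = z' then 1 else 0) + (if y = z' then \<eta> else 0) else 0) +
      (\<Sum>x\<in>\<Lambda>. \<Sum>y\<in>\<Lambda>. if y = z then (if z = z' then \<epsilon> * \<eta> else 0) + (if x = z' then \<epsilon> else 0) else 0)"
    by (simp only: sum.cartesian_product' sum.distrib)
  also have "(\<Sum>x\<in>\<Lambda>. \<Sum>y\<in>\<Lambda>. if x = z then (if z = z' then 1 else 0) + (if y = z' then \<eta> else 0) else 0) =
      (if z = z' then real (card \<Lambda>) else 0) + \<eta>"
    using assms by (subst sum.swap) (simp add: sum.distrib)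
  also have "(\<Sum>x\<in>\<Lambda>. \<Sum>y\<in>\<Lambda>. if y = z then (if z = z' then \<epsilon> * \<eta> else 0) + (if x = z' then \<epsilon> else 0) else 0) =
      (if z = z' then \<epsilon> * \<eta> * real (card \<Lambda>) else 0) + \<epsilon>"
    using assms by (simp add: sum.distrib)
  finally show ?thesis
    by (simp add: algebra_simps)
qed

lemma incidence_swap:
  "incidence 1 (prod.swap s) z = incidence 1 s z"
  "incidence (- 1) (prod.swap s) z = - incidence (- 1) s z"
  "fst s = snd s \<Longrightarrow> incidence (- 1) s z = 0"
  by (simp_all add: incidence_def)

text \<open>
  Half the difference of the cases \<open>\<epsilon> = 1\<close> and \<open>\<epsilon> = -1\<close> is \<open>[M = L'] + [M' = L]\<close> for \<open>s = (L, M)\<close> and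
  \<open>t = (L', M')\<close>, the low-rank part of \<open>H\<close>.
\<close>

lemma sum_incidence_dual:
  assumes "finite \<Lambda>" and "s \<in> \<Lambda> \<times> \<Lambda>" and "t \<in> \<Lambda> \<times> \<Lambda>"
  shows "(\<Sum>z\<in>\<Lambda>. incidence \<epsilon> s z * incidence \<epsilon> t z) =
    (if fst s = fst t then 1 else 0) + (if snd s = snd t then \<epsilon>\<^sup>2 else 0) +
    (if fst s = snd t then \<epsilon> else 0) + (if snd s = fst t then \<epsilon> else 0)"
proof -
  have "incidence \<epsilon> s z * incidence \<epsilon> t z =
      (if fst s = z then (if fst s = fst t then 1 else 0) + (if fst s = snd t then \<epsilon> else 0) else 0) +
      (if snd s = z then (if snd s = fst t then \<epsilon> else 0) + (if snd s = snd t then \<epsilon>\<^sup>2 else 0) else 0)" for z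
    by (auto simp: incidence_def algebra_simps power2_eq_square)
  then show ?thesis
    using assms by (auto simp: sum.distrib)
qed

text \<open>
  The entries of \<open>H\<close>: a matrix with kernel \<open>fst s\<close> and image \<open>snd s\<close> has product zero, in some order,
  with one of kernel \<open>fst t\<close> and image \<open>snd t\<close>.
\<close>

definition composability :: "'l \<times> 'l \<Rightarrow> 'l \<times> 'l \<Rightarrow> real" where
  "composability s t = (if snd s = fst t \<or> snd t = fst s then 1 else 0)"

text \<open>
  The matrix is \<^const>\<open>swap_kernel\<close> minus \<open>c/2\<close> times the symmetric part plus \<open>c/2\<close> times the
  antisymmetric part, and both parts are removed by updates indexed by \<open>\<Lambda>\<close>. Each of the
  two small matrices is a scalar matrix plus a constant one. In the antisymmetric case its eigenvalue on the
  constant vector is \<open>1\<close>, so this case contributes only a power with exponent \<open>card \<Lambda> - 1\<close>.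
\<close>

lemma det_composability:
  fixes l c a :: real
  assumes ts: "distinct ts" "set ts = \<Lambda> \<times> \<Lambda>" and fin: "finite \<Lambda>" and ne: "\<Lambda> \<noteq> {}"
    and l: "l \<noteq> c" "l + c \<noteq> 0" "l + c + 1 \<noteq> 0"
    and a: "a = 1 - c * card \<Lambda> / (l + c) - 2 * c * (1 / (l + c + 1) - 1 / (l + c))" "a \<noteq> 0"
    and b: "l - c + c * card \<Lambda> \<noteq> 0"
  shows "det (indexed_mat ts (\<lambda>s t. (if s = t then l else 0) -
      (c * composability s t - (if s = t then if fst s = snd s then 1 else 0 else 0)))) =
    (l + c + 1) ^ card \<Lambda> * ((l - c) * (l + c)) ^ (card \<Lambda> choose 2) *
    (a ^ (card \<Lambda> - 1) * (a - c * card \<Lambda> / (l + c))) *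
    ((l - c + c * card \<Lambda>) / (l - c)) ^ (card \<Lambda> - 1)"
proof -
  let ?q = "card \<Lambda>"
  obtain zs where zs: "distinct zs" "set zs = \<Lambda>"
    using finite_distinct_list[OF fin] by blast
  have len: "length zs = ?q" and zs_ne: "zs \<noteq> []"
    using zs ne distinct_card by fastforce+
  have l_c: "l - c \<noteq> 0"
    using l(1) by simp
  let ?N = "swap_kernel l c"
  let ?P = "incidence 1 :: 'a \<times> 'a \<Rightarrow> 'a \<Rightarrow> real" and ?M = "incidence (- 1) :: 'a \<times> 'a \<Rightarrow> 'a \<Rightarrow> real"
  let ?N' = "\<lambda>s t. ?N s t - (\<Sum>z\<in>set zs. ?P s z * (c / 2 * ?P t z))"
  let ?w = "\<lambda>s. l + c + (if fst s = snd s then 1 else 0)"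
  have "det (indexed_mat ts (\<lambda>s t. (if s = t then l else 0) -
      (c * composability s t - (if s = t then if fst s = snd s then 1 else 0 else 0)))) =
      det (indexed_mat ts (\<lambda>s t. ?N' s t - (\<Sum>z\<in>set zs. ?M s z * (- c / 2 * ?M t z))))"
  proof (rule arg_cong[where f = det], rule indexed_mat_cong, goal_cases)
    case (1 s t)
    then have st: "s \<in> \<Lambda> \<times> \<Lambda>" "t \<in> \<Lambda> \<times> \<Lambda>"
      by (simp_all add: ts(2))
    have P: "(\<Sum>z\<in>\<Lambda>. ?P s z * (c / 2 * ?P t z)) = c / 2 * (\<Sum>z\<in>\<Lambda>. ?P s z * ?P t z)"
      by (simp add: sum_distrib_left mult_ac)
    have M: "(\<Sum>z\<in>\<Lambda>. ?M s z * (- c / 2 * ?M t z)) = - c / 2 * (\<Sum>z\<in>\<Lambda>. ?M s z * ?M t z)"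
      by (simp add: sum_distrib_left mult_ac)
    show ?case
    proof (cases s; cases t)
      fix x y x' y' assume eqs: "s = (x, y)" "t = (x', y')"
      show ?thesis
        unfolding zs(2) P M sum_incidence_dual[OF fin st]
        unfolding swap_kernel_def composability_def eqs
        by (cases "x = x'"; cases "y = y'"; cases "x = y'"; cases "y = x'"; cases "x = y"; cases "x' = y'")
          simp_all
    qed
  qed
  also have "\<dots> = det (indexed_mat ts ?N') *
      det (indexed_mat zs (\<lambda>z z'. (if z = z' then 1 else 0) -
        (\<Sum>s\<in>set ts. - c / 2 * ?M s z * (?M s z' / (l - c)))))"
  proof (rule det_indexed_mat_low_rank_update[OF ts(1) zs(1)])
    fix s z assume "s \<in> set ts" "z \<in> set zs"
    then have s: "s \<in> \<Lambda> \<times> \<Lambda>" and z: "z \<in> \<Lambda>"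
      by (simp_all add: ts(2) zs(2))
    \<comment> \<open>The columns of \<open>?M\<close> change sign under swapping and vanish on the diagonal, so \<open>?N\<close> multiplies them
      by \<open>l - c\<close>; the symmetric term kills them by orthogonality.\<close>
    have "(\<Sum>t\<in>\<Lambda> \<times> \<Lambda>. (\<Sum>z'\<in>\<Lambda>. ?P s z' * (c / 2 * ?P t z')) * (?M t z / (l - c))) =
        (\<Sum>z'\<in>\<Lambda>. ?P s z' * (c / 2) / (l - c) * (\<Sum>t\<in>\<Lambda> \<times> \<Lambda>. ?P t z' * ?M t z))"
      unfolding sum_distrib_left sum_distrib_right
      by (subst sum.swap) (simp add: mult_ac)
    also have "\<dots> = 0"
    proof (rule sum.neutral, intro ballI)
      fix z' assume "z' \<in> \<Lambda>"
      from sum_incidence[OF fin this z, of 1 "- 1"]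
      show "?P s z' * (c / 2) / (l - c) * (\<Sum>t\<in>\<Lambda> \<times> \<Lambda>. ?P t z' * ?M t z) = 0"
        by simp
    qed
    finally have "(\<Sum>t\<in>set ts. ?N' s t * (?M t z / (l - c))) =
        (\<Sum>t\<in>\<Lambda> \<times> \<Lambda>. ?N s t * (?M t z / (l - c)))"
      by (simp only: left_diff_distrib sum_subtractf ts(2) zs(2) diff_zero)
    also have "\<dots> = ?M s z"
      unfolding sum_swap_kernel[OF fin s] incidence_swap(2)
    proof (cases "fst s = snd s")
      case False
      have "l * (?M s z / (l - c)) + c * (- ?M s z / (l - c)) = (l - c) * ?M s z / (l - c)"
        by (simp add: algebra_simps diff_divide_distrib)
      with False l(1) show "(l + (if fst s = snd s then 1 else 0)) * (?M s z / (l - c)) +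
          c * (- ?M s z / (l - c)) = ?M s z"
        by simp
    qed (simp add: incidence_swap)
    finally show "(\<Sum>t\<in>set ts. ?N' s t * (?M t z / (l - c))) = ?M s z" .
  qed
  also have "det (indexed_mat ts ?N') = det (indexed_mat ts ?N) *
      det (indexed_mat zs (\<lambda>z z'. (if z = z' then 1 else 0) -
        (\<Sum>s\<in>set ts. c / 2 * ?P s z * (?P s z' / ?w s))))"
  proof (rule det_indexed_mat_low_rank_update[OF ts(1) zs(1)])
    fix s z assume "s \<in> set ts" "z \<in> set zs"
    then have s: "s \<in> \<Lambda> \<times> \<Lambda>"
      by (simp add: ts(2))
    \<comment> \<open>On functions invariant under swapping, \<open>?N\<close> acts as multiplication by \<open>?w\<close>.\<close>
    show "(\<Sum>t\<in>set ts. ?N s t * (?P t z / ?w t)) = ?P s z"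
    proof -
      have "?w s \<noteq> 0"
        using l by simp
      moreover have "fst (prod.swap s) = snd (prod.swap s) \<longleftrightarrow> fst s = snd s"
        by auto
      moreover have "(l + d) * (x / (l + c + d)) + c * (x / (l + c + d)) = (l + c + d) * x / (l + c + d)"
        for d x :: real
        by (simp add: algebra_simps add_divide_distrib)
      ultimately show ?thesis
        unfolding ts(2) sum_swap_kernel[OF fin s] incidence_swap(1) by simp
    qed
  qed
  also have "det (indexed_mat ts ?N) = (l + c + 1) ^ ?q * ((l - c) * (l + c)) ^ (?q choose 2)"
    by (rule det_swap_kernel[OF ts fin l(1)])
  also have "indexed_mat zs (\<lambda>z z'. (if z = z' then 1 else 0) -
        (\<Sum>s\<in>set ts. c / 2 * ?P s z * (?P s z' / ?w s))) =
      indexed_mat zs (\<lambda>z z'. (if z = z' then a else 0) + - c / (l + c))"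
  proof (rule indexed_mat_cong)
    fix z z' assume "z \<in> set zs" "z' \<in> set zs"
    then have z: "z \<in> \<Lambda>" "z' \<in> \<Lambda>"
      by (simp_all add: zs(2))
    \<comment> \<open>The weight \<open>1 / ?w\<close> is \<open>1 / (l + c)\<close>, corrected by \<open>v\<close> on the diagonal; there the product of the two
      incidences is \<open>4\<close> at \<open>(z, z)\<close> if \<open>z = z'\<close>, and zero otherwise.\<close>
    define v where "v = 1 / (l + c + 1) - 1 / (l + c)"
    have "?P s z * ?P s z' / ?w s = 1 / (l + c) * (?P s z * ?P s z') +
        (if s = (z, z) then if z = z' then 4 * v else 0 else 0)" for s
      by (cases s) (auto simp: incidence_def v_def algebra_simps)
    then have "(\<Sum>s\<in>\<Lambda> \<times> \<Lambda>. ?P s z * ?P s z' / ?w s) =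
        1 / (l + c) * (\<Sum>s\<in>\<Lambda> \<times> \<Lambda>. ?P s z * ?P s z') + (if z = z' then 4 * v else 0)"
      using z fin by (simp only: sum.distrib sum_distrib_left) simp
    also have "(\<Sum>s\<in>\<Lambda> \<times> \<Lambda>. ?P s z * ?P s z') = (if z = z' then 2 * real ?q else 0) + 2"
      unfolding sum_incidence[OF fin z] by simp
    finally have sum: "(\<Sum>s\<in>\<Lambda> \<times> \<Lambda>. ?P s z * ?P s z' / ?w s) =
        1 / (l + c) * ((if z = z' then 2 * real ?q else 0) + 2) + (if z = z' then 4 * v else 0)" .
    have "(\<Sum>s\<in>set ts. c / 2 * ?P s z * (?P s z' / ?w s)) =
        c / 2 * (\<Sum>s\<in>\<Lambda> \<times> \<Lambda>. ?P s z * ?P s z' / ?w s)"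
      unfolding ts(2) sum_distrib_left by (rule sum.cong) simp_all
    also have "\<dots> = (if z = z' then 1 - a else 0) + c / (l + c)"
    proof (cases "z = z'")
      case True
      have "c / 2 * (1 / (l + c) * (2 * real ?q + 2) + 4 * v) = c * ?q / (l + c) + c / (l + c) + 2 * c * v"
        by (simp add: distrib_left add_divide_distrib)
      with True show ?thesis
        unfolding sum a(1) v_def[symmetric] by simp
    qed (simp add: sum)
    finally have sum': "(\<Sum>s\<in>set ts. c / 2 * ?P s z * (?P s z' / ?w s)) =
        (if z = z' then 1 - a else 0) + c / (l + c)" .
    show "(if z = z' then 1 else 0) - (\<Sum>s\<in>set ts. c / 2 * ?P s z * (?P s z' / ?w s)) =
        (if z = z' then a else 0) + - c / (l + c)"
      unfolding sum' by simp
  qed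
  also have "det \<dots> = a ^ (?q - 1) * (a - c * ?q / (l + c))"
  proof -
    have "a + real ?q * (- c / (l + c)) = a - c * ?q / (l + c)"
      by simp
    then show ?thesis
      using det_indexed_mat_scalar_plus_constant[OF zs(1) zs_ne a(2), of "- c / (l + c)", unfolded len]
      by (simp only:)
  qed
  also have "indexed_mat zs (\<lambda>z z'. (if z = z' then 1 else 0) -
        (\<Sum>s\<in>set ts. - c / 2 * ?M s z * (?M s z' / (l - c)))) =
      indexed_mat zs (\<lambda>z z'. (if z = z' then (l - c + c * ?q) / (l - c) else 0) + - c / (l - c))"
  proof (rule indexed_mat_cong)
    fix z z' assume "z \<in> set zs" "z' \<in> set zs"
    then have z: "z \<in> \<Lambda>" "z' \<in> \<Lambda>"
      by (simp_all add: zs(2))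
    have "(\<Sum>s\<in>set ts. - c / 2 * ?M s z * (?M s z' / (l - c))) =
        - c / 2 / (l - c) * (\<Sum>s\<in>\<Lambda> \<times> \<Lambda>. ?M s z * ?M s z')"
      unfolding ts(2) sum_distrib_left by (rule sum.cong) simp_all
    also have "(\<Sum>s\<in>\<Lambda> \<times> \<Lambda>. ?M s z * ?M s z') = (if z = z' then 2 * real ?q else 0) - 2"
      unfolding sum_incidence[OF fin z] by simp
    also have "- c / 2 / (l - c) * \<dots> = (if z = z' then - (c * ?q / (l - c)) else 0) + c / (l - c)"
    proof -
      have "- k / 2 * ((if z = z' then 2 * x else 0) - 2) = (if z = z' then - (k * x) else 0) + k"
        for k x :: real
        by (simp add: right_diff_distrib)
      moreover have "- c / 2 / (l - c) = - (c / (l - c)) / 2"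
        by (simp only: divide_divide_eq_left minus_divide_left mult.commute)
      ultimately show ?thesis
        by (simp only: times_divide_eq_left)
    qed
    finally have sum: "(\<Sum>s\<in>set ts. - c / 2 * ?M s z * (?M s z' / (l - c))) =
        (if z = z' then - (c * ?q / (l - c)) else 0) + c / (l - c)" .
    have "(if z = z' then 1 else 0) - (\<Sum>s\<in>set ts. - c / 2 * ?M s z * (?M s z' / (l - c))) =
        (if z = z' then 1 + c * ?q / (l - c) else 0) + - c / (l - c)"
      unfolding sum by simp
    also have "1 + c * ?q / (l - c) = (l - c + c * ?q) / (l - c)"
      by (simp only: add_divide_distrib divide_self[OF l_c])
    finally show "(if z = z' then 1 else 0) - (\<Sum>s\<in>set ts. - c / 2 * ?M s z * (?M s z' / (l - c))) =
        (if z = z' then (l - c + c * ?q) / (l - c) else 0) + - c / (l - c)" .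
  qed
  also have "det \<dots> = ((l - c + c * ?q) / (l - c)) ^ (?q - 1) *
      ((l - c + c * ?q) / (l - c) + ?q * (- c / (l - c)))"
  proof -
    have "(l - c + c * ?q) / (l - c) \<noteq> 0"
      using b l(1) by simp
    from det_indexed_mat_scalar_plus_constant[OF zs(1) zs_ne this, of "- c / (l - c)", unfolded len]
    show ?thesis .
  qed
  also have "(l - c + c * ?q) / (l - c) + ?q * (- c / (l - c)) = 1"
    by (simp only: add_divide_distrib divide_self[OF l_c]) simp
  finally show ?thesis
    by (simp only: mult_1_right)
qed

section \<open>The characteristic polynomials of the matrix of types and of its blow-up\<close>

lemma quadratic_from_roots:
  fixes k d x :: real
  assumes "d \<ge> 0"
  shows "(x - (k / 2 + 1 / 2 * sqrt d)) * (x - (k / 2 - 1 / 2 * sqrt d)) = x\<^sup>2 - k * x + (k\<^sup>2 - d) / 4"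
proof -
  have "(x - (k / 2 + 1 / 2 * sqrt d)) * (x - (k / 2 - 1 / 2 * sqrt d)) =
      x\<^sup>2 - k * x + (k\<^sup>2 - (sqrt d)\<^sup>2) / 4"
    by (simp add: algebra_simps power2_eq_square diff_divide_distrib)
  then show ?thesis
    using assms by simp
qed

lemma Delta_nonneg:
  assumes "p \<ge> 2"
  shows "Delta p \<ge> 0"
proof -
  have "real p \<ge> 2" using assms by simp
  then have "real p ^ 2 \<ge> 2 * real p" "real p ^ 4 \<ge> 4 * real p ^ 2"
    using mult_right_mono[of 2 "real p" "real p"] mult_right_mono[of 4 "real p ^ 2" "real p ^ 2"]
      power_mono[of 2 "real p" 2]
    by (simp_all add: power2_eq_square power4_eq_xxxx mult_ac)
  then show ?thesis
    unfolding Delta_def by linarith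
qed

lemma Theta_nonneg:
  assumes "p \<ge> 2"
  shows "Theta p \<ge> 0"
proof -
  have "real p \<ge> 2" using assms by simp
  then have "real p ^ 2 \<ge> 2 * real p" "real p ^ 4 \<ge> 4 * real p ^ 2"
    using mult_right_mono[of 2 "real p" "real p"] mult_right_mono[of 4 "real p ^ 2" "real p ^ 2"]
      power_mono[of 2 "real p" 2]
    by (simp_all add: power2_eq_square power4_eq_xxxx mult_ac)
  then show ?thesis
    unfolding Theta_def by linarith
qed

lemma lambda_quadratic:
  assumes "p \<ge> 2"
  shows "(x - lambda_plus p) * (x - lambda_minus p) =
    x\<^sup>2 - (2 * real p ^ 2 - 2 * real p - 1) * x - (real p - 1) * (2 * real p ^ 2 + real p - 2)"
proof -
  have "lambda_plus p = (2 * real p ^ 2 - 2 * real p - 1) / 2 + 1 / 2 * sqrt (Delta p)"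
    "lambda_minus p = (2 * real p ^ 2 - 2 * real p - 1) / 2 - 1 / 2 * sqrt (Delta p)"
    by (simp_all add: lambda_plus_def lambda_minus_def add_divide_distrib diff_divide_distrib)
  moreover have "(2 * real p ^ 2 - 2 * real p - 1)\<^sup>2 - Delta p =
      4 * (- ((real p - 1) * (2 * real p ^ 2 + real p - 2)))"
    by (simp add: Delta_def algebra_simps power2_eq_square power4_eq_xxxx)
  ultimately show ?thesis
    by (simp only: quadratic_from_roots[OF Delta_nonneg[OF assms]])
qed

lemma mu_quadratic:
  assumes "p \<ge> 2"
  shows "(x - mu_plus p) * (x - mu_minus p) =
    x\<^sup>2 - real p * (real p - 2) * x + (real p - 1) * (2 - real p ^ 2)"
proof -
  have "mu_plus p = real p * (real p - 2) / 2 + 1 / 2 * sqrt (Theta p)"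
    "mu_minus p = real p * (real p - 2) / 2 - 1 / 2 * sqrt (Theta p)"
    by (simp_all add: mu_plus_def mu_minus_def add_divide_distrib diff_divide_distrib)
  moreover have "(real p * (real p - 2))\<^sup>2 - Theta p = 4 * ((real p - 1) * (2 - real p ^ 2))"
    by (simp add: Theta_def algebra_simps power2_eq_square power4_eq_xxxx)
  ultimately show ?thesis
    by (simp only: quadratic_from_roots[OF Theta_nonneg[OF assms]])
qed

text \<open>
  The update factors are rational functions of \<open>l\<close> whose numerators are the quadratics with roots
  \<open>\<mu>\<^sub>\<plusminus>\<close> and \<open>\<lambda>\<^sub>\<plusminus>\<close> and the linear polynomial with root \<open>- p (p - 1)\<close>. Their denominators cancel all
  powers of \<open>l + c + 1\<close>, and \<open>p\<close> resp. \<open>p + 1\<close> of the powers of \<open>l - c\<close> and \<open>l + c\<close> that come from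
  the unordered pairs; \<open>m1\<close> and \<open>m2\<close> are the exponents that survive. The second
  statement shows for which \<open>l\<close> the number \<open>a\<close> vanishes.
\<close>

lemma spectral_factor_identity:
  fixes p m1 m2 :: nat and l :: real
  assumes p: "p \<ge> 2" and m: "Suc p choose 2 = p + m1" "Suc p choose 2 = Suc p + m2"
    and c: "c = real p - 1"
    and l: "l \<noteq> c" "l + c \<noteq> 0" "l + c + 1 \<noteq> 0"
    and a: "a = 1 - c * real (Suc p) / (l + c) - 2 * c * (1 / (l + c + 1) - 1 / (l + c))"
  shows "(l + c + 1) ^ Suc p * ((l - c) * (l + c)) ^ (Suc p choose 2) *
    (a ^ p * (a - c * real (Suc p) / (l + c))) * ((l - c + c * real (Suc p)) / (l - c)) ^ p =
    (l - lambda_plus p) * (l - lambda_minus p) * (l - mu_plus p) ^ p * (l - mu_minus p) ^ p *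
    (l + real p * (real p - 1)) ^ p * (l - c) ^ m1 * (l + c) ^ m2"
    (is "?lhs = _")
    and "a = (l - mu_plus p) * (l - mu_minus p) / ((l + c) * (l + c + 1))"
proof -
  define Q1 Q2 r where Q1: "Q1 = (l - lambda_plus p) * (l - lambda_minus p)"
    and Q2: "Q2 = (l - mu_plus p) * (l - mu_minus p)" and r: "r = l + real p * (real p - 1)"
  define u v w where u: "u = l + c" and v: "v = l + c + 1" and w: "w = l - c"
  have nz: "u \<noteq> 0" "v \<noteq> 0" "w \<noteq> 0"
    using l by (auto simp: u v w)
  have a2: "a = Q2 / (u * v)"
  proof -
    have "a * (u * v) = (1 - c * real (Suc p) / u - 2 * c * (1 / v - 1 / u)) * (u * v)"
      unfolding a u v ..
    also have "\<dots> = u * v - c * real (Suc p) * v - 2 * c * (u - v)"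
      using nz by (simp add: field_simps)
    also have "\<dots> = Q2"
      unfolding Q2 mu_quadratic[OF p] u v c by (simp add: algebra_simps power2_eq_square)
    finally show ?thesis
      using nz by (simp add: field_simps)
  qed
  then show "a = (l - mu_plus p) * (l - mu_minus p) / ((l + c) * (l + c + 1))"
    by (simp add: Q2 u v)
  have a1: "a - c * real (Suc p) / (l + c) = Q1 / (u * v)"
  proof -
    have "Q2 - c * real (Suc p) * v = Q1"
      unfolding Q2 Q1 mu_quadratic[OF p] lambda_quadratic[OF p] v c
      by (simp add: algebra_simps power2_eq_square power3_eq_cube)
    then show ?thesis
      using nz unfolding a2 u[symmetric] by (simp add: field_simps)
  qed
  have a3: "l - c + c * real (Suc p) = r"
    by (simp add: r c algebra_simps)
  have "?lhs = v ^ Suc p * (w * u) ^ (Suc p choose 2) *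
      ((Q2 / (u * v)) ^ p * (Q1 / (u * v))) * (r / w) ^ p"
    unfolding a1 a3 unfolding a2 u v w ..
  also have "\<dots> = v ^ Suc p * (w ^ (p + m1) * u ^ (Suc p + m2)) *
      ((Q2 / (u * v)) ^ p * (Q1 / (u * v))) * (r / w) ^ p"
  proof -
    have "w ^ (Suc p choose 2) = w ^ (p + m1)" "u ^ (Suc p choose 2) = u ^ (Suc p + m2)"
      by (simp_all only: m(1), simp only: m(1)[symmetric] m(2))
    then show ?thesis
      by (simp only: power_mult_distrib[of w u])
  qed
  also have "\<dots> = Q1 * Q2 ^ p * r ^ p * w ^ m1 * u ^ m2"
    using nz by (simp add: power_divide power_mult_distrib power_add)
  finally show "?lhs = (l - lambda_plus p) * (l - lambda_minus p) * (l - mu_plus p) ^ p * (l - mu_minus p) ^ p *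
    (l + real p * (real p - 1)) ^ p * (l - c) ^ m1 * (l + c) ^ m2"
    by (simp add: Q1 Q2 r u w power_mult_distrib mult_ac)
qed

text \<open>
  The exponents \<open>m1\<close> and \<open>m2\<close> of \<open>spectral_factor_identity\<close>, counted from the unordered pairs of \<open>p + 1\<close> lines.
\<close>

lemma multiplicity_identities:
  shows "Suc p choose 2 = p + p * (p - 1) div 2"
    and "p \<ge> 2 \<Longrightarrow> Suc p choose 2 = Suc p + (p + 1) * (p - 2) div 2"
proof -
  show "Suc p choose 2 = p + p * (p - 1) div 2"
    by (cases p) (simp_all add: choose_two algebra_simps)
  assume "p \<ge> 2"
  then obtain k where "p = k + 2"
    by (metis add.commute le_Suc_ex)
  then show "Suc p choose 2 = Suc p + (p + 1) * (p - 2) div 2"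
    by (simp add: choose_two algebra_simps)
qed

lemma char_poly_B_mat:
  fixes p :: nat
  assumes p: "p \<ge> 2" and ts: "distinct ts" "set ts = \<Lambda> \<times> \<Lambda>"
    and card: "card \<Lambda> = Suc p"
  shows "char_poly (B_mat p ts) =
      [:- lambda_plus p, 1:] * [:- lambda_minus p, 1:]
      * [:- mu_plus p, 1:] ^ p * [:- mu_minus p, 1:] ^ p
      * [:real p * (real p - 1), 1:] ^ p
      * [:- (real p - 1), 1:] ^ (p * (p - 1) div 2)
      * [:real p - 1, 1:] ^ ((p + 1) * (p - 2) div 2)"
    (is "_ = ?R")
proof -
  define c where "c = real p - 1"
  have fin: "finite \<Lambda>" and ne: "\<Lambda> \<noteq> {}"
    using card by (auto intro: card_ge_0_finite)
  have B: "B_mat p ts = indexed_mat ts (\<lambda>s t. c * composability s t -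
      (if s = t then if fst s = snd s then 1 else 0 else 0))"
    unfolding B_mat_def H_mat_def D_mat_def c_def
    by (rule eq_matI) (auto simp: indexed_mat_def composability_def split: prod.splits)
  show ?thesis
  proof (rule poly_eq_if_eq_outside_finite)
    let ?S = "{c, - c, - c - 1, mu_plus p, mu_minus p, - (real p * (real p - 1))}"
    show "finite ?S" by simp
    fix l assume "l \<notin> ?S"
    then have l: "l \<noteq> c" "l + c \<noteq> 0" "l + c + 1 \<noteq> 0"
      and mu: "l - mu_plus p \<noteq> 0" "l - mu_minus p \<noteq> 0"
      and r: "l + real p * (real p - 1) \<noteq> 0"
      by (auto simp: add_eq_0_iff2 algebra_simps)
    define a where "a = 1 - c * real (Suc p) / (l + c) - 2 * c * (1 / (l + c + 1) - 1 / (l + c))"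
    note id = spectral_factor_identity[OF p multiplicity_identities(1)
        multiplicity_identities(2)[OF p] c_def l a_def]
    have a: "a = 1 - c * real (card \<Lambda>) / (l + c) - 2 * c * (1 / (l + c + 1) - 1 / (l + c))" "a \<noteq> 0"
      unfolding card by (rule a_def) (use id(2) l mu in simp)
    have b: "l - c + c * real (card \<Lambda>) \<noteq> 0"
      using r unfolding card c_def by (simp add: algebra_simps)
    have "poly (char_poly (B_mat p ts)) l = (l - lambda_plus p) * (l - lambda_minus p) *
        (l - mu_plus p) ^ p * (l - mu_minus p) ^ p * (l + real p * (real p - 1)) ^ p *
        (l - c) ^ (p * (p - 1) div 2) * (l + c) ^ ((p + 1) * (p - 2) div 2)"
      unfolding B poly_char_poly_indexed_mat[OF ts(1)] det_composability[OF ts fin ne l a b]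
      unfolding card diff_Suc_1 by (rule id(1))
    also have "\<dots> = poly ?R l"
    proof -
      have linear: "poly [:b, 1:] l = l + b" for b
        by simp
      show ?thesis
        by (simp only: poly_mult poly_power linear c_def diff_conv_add_uminus)
    qed
    finally show "poly (char_poly (B_mat p ts)) l = poly ?R l" .
  qed
qed

text \<open>
  Copies of a pair \<open>(L, L)\<close> would be adjacent to themselves; deleting these loops is what the matrix
  \<open>D\<close> records. Hence the \<open>p + 1\<close> pairs on the diagonal contribute factors with root \<open>-1\<close>, and the
  other \<open>p (p + 1)\<close> pairs contribute factors with root \<open>0\<close>.
\<close>

lemma char_poly_composability_blow_up:
  fixes p :: nat
  assumes p: "p \<ge> 2" and vs: "distinct vs"
    and ts: "distinct ts" "set ts = \<Lambda> \<times> \<Lambda>" and card: "card \<Lambda> = Suc p"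
    and type: "\<And>x. x \<in> set vs \<Longrightarrow> type x \<in> \<Lambda> \<times> \<Lambda>"
    and fibre: "\<And>t. t \<in> \<Lambda> \<times> \<Lambda> \<Longrightarrow> card {x \<in> set vs. type x = t} = p - 1"
  shows "char_poly (indexed_mat vs (\<lambda>x y. if x \<noteq> y \<and>
      (snd (type x) = fst (type y) \<or> snd (type y) = fst (type x)) then 1 else 0)) =
    [:0, 1:] ^ (p * (p + 1) * (p - 2)) * [:1, 1:] ^ ((p + 1) * (p - 2)) * char_poly (B_mat p ts)"
proof -
  let ?d = "\<lambda>t :: 'b \<times> 'b. if fst t = snd t then 1 else 0 :: real"
  have fin: "finite \<Lambda>"
    using card by (auto intro: card_ge_0_finite)
  have Suc: "Suc (p - 2) = p - 1"
    using p by simp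
  have A: "indexed_mat vs (\<lambda>x y. if x \<noteq> y \<and>
      (snd (type x) = fst (type y) \<or> snd (type y) = fst (type x)) then 1 else 0) =
      indexed_mat vs (\<lambda>x y. composability (type x) (type y) - (if x = y then ?d (type x) else 0))"
    by (rule indexed_mat_cong) (auto simp: composability_def)
  have B: "B_mat p ts = indexed_mat ts (\<lambda>s t. of_nat (Suc (p - 2)) * composability s t -
      (if s = t then ?d s else 0))"
    unfolding B_mat_def H_mat_def D_mat_def Suc
    by (rule eq_matI) (use p in \<open>auto simp: indexed_mat_def composability_def of_nat_diff split: prod.splits\<close>)
  have "char_poly (indexed_mat vs (\<lambda>x y. composability (type x) (type y) - (if x = y then ?d (type x) else 0))) =
      (\<Prod>t\<in>\<Lambda> \<times> \<Lambda>. [:?d t, 1:] ^ (p - 2)) * char_poly (B_mat p ts)"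
    unfolding B ts(2)[symmetric]
    by (rule char_poly_blow_up[OF vs ts(1)]) (use type fibre in \<open>simp_all add: ts(2) Suc\<close>)
  also have "(\<Prod>t\<in>\<Lambda> \<times> \<Lambda>. [:?d t, 1:] ^ (p - 2)) =
      (\<Prod>t\<in>\<Lambda> \<times> \<Lambda> - (\<lambda>x. (x, x)) ` \<Lambda>. [:?d t, 1:] ^ (p - 2)) * (\<Prod>t\<in>(\<lambda>x. (x, x)) ` \<Lambda>. [:?d t, 1:] ^ (p - 2))"
    by (rule prod.subset_diff) (use fin in auto)
  also have "(\<Prod>t\<in>\<Lambda> \<times> \<Lambda> - (\<lambda>x. (x, x)) ` \<Lambda>. [:?d t, 1:] ^ (p - 2)) =
      (\<Prod>t\<in>\<Lambda> \<times> \<Lambda> - (\<lambda>x. (x, x)) ` \<Lambda>. [:0, 1:] ^ (p - 2))"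
    by (rule prod.cong) auto
  also have "\<dots> = [:0, 1:] ^ (p * (p + 1) * (p - 2))"
  proof -
    have "card (\<Lambda> \<times> \<Lambda> - (\<lambda>x. (x, x)) ` \<Lambda>) = p * (p + 1)"
      using fin card by (subst card_Diff_subset) (auto simp: card_image inj_on_def card_cartesian_product)
    then show ?thesis
      by (simp only: prod_constant power_mult[symmetric] mult_ac)
  qed
  also have "(\<Prod>t\<in>(\<lambda>x. (x, x)) ` \<Lambda>. [:?d t, 1:] ^ (p - 2)) = [:1, 1:] ^ ((p + 1) * (p - 2))"
  proof -
    have "(\<Prod>t\<in>(\<lambda>x. (x, x)) ` \<Lambda>. [:?d t, 1:] ^ (p - 2)) = (\<Prod>t\<in>\<Lambda>. [:1, 1:] ^ (p - 2))"
      by (subst prod.reindex) (auto simp: inj_on_def)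
    then show ?thesis
      by (simp only: prod_constant power_mult[symmetric] mult_ac card Suc_eq_plus1)
  qed
  finally show ?thesis
    unfolding A .
qed

section \<open>Lines in the plane over the field with p elements\<close>

text \<open>
  Normalised representatives of the points of the projective line: the first nonzero coordinate is
  \<open>1\<close>.
\<close>

definition proj_points :: "nat \<Rightarrow> (int \<times> int) set" where
  "proj_points p = insert (0, 1) ((\<lambda>t. (1, t)) ` {0..<int p})"

lemma card_proj_points: "card (proj_points p) = Suc p"
proof -
  have "card ((\<lambda>t :: int. (1 :: int, t)) ` {0..<int p}) = p"
    by (simp add: card_image inj_on_def)
  then show ?thesis
    unfolding proj_points_def by (subst card_insert_disjoint) auto
qed

lemma proj_points_cases:
  assumes "u \<in> proj_points p"
  obtains (infinity) "u = (0, 1)" | (finite) t where "u = (1, t)" "0 \<le> t" "t < int p"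
  using assms by (auto simp: proj_points_def)

lemma inverse_mod_prime:
  fixes c :: int
  assumes "prime p" and "\<not> int p dvd c"
  obtains d where "[c * d = 1] (mod int p)"
proof -
  have "coprime c (int p)"
    using assms by (metis coprime_commute prime_imp_coprime prime_nat_int_transfer)
  then show ?thesis
    using cong_solve_coprime_int that by blast
qed

lemma proj_points_representative:
  fixes a b :: int
  assumes p: "prime p" and nz: "\<not> (int p dvd a \<and> int p dvd b)"
  obtains u c where "u \<in> proj_points p" "c \<in> {1..<int p}"
    "[a = c * fst u] (mod int p)" "[b = c * snd u] (mod int p)"
proof -
  have pos: "int p > 0"
    using p prime_gt_0_nat by simp
  have rep: "c mod int p \<in> {1..<int p}" if "\<not> int p dvd c" for c
    using that pos_mod_sign[OF pos, of c] pos_mod_bound[OF pos, of c]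
    by (auto simp: dvd_eq_mod_eq_0 order_le_less)
  show ?thesis
  proof (cases "int p dvd a")
    case True
    with nz have "\<not> int p dvd b" by simp
    from rep[OF this] show ?thesis
      by (rule that[of "(0, 1)", rotated])
        (use True in \<open>auto simp: proj_points_def cong_0_iff cong_def\<close>)
  next
    case False
    then obtain d where d: "[a * d = 1] (mod int p)"
      using inverse_mod_prime[OF p] by blast
    have "[b = (a * d) * b] (mod int p)"
      using cong_scalar_right[OF d, of b] by (simp add: cong_sym)
    then have "[b = (a mod int p) * ((d * b) mod int p)] (mod int p)"
      by (simp add: cong_def mod_simps mult.assoc)
    then show ?thesis
      by (intro that[of "(1, (d * b) mod int p)" "a mod int p", OF _ rep[OF False]])
        (use pos in \<open>auto simp: proj_points_def cong_def\<close>)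
  qed
qed

text \<open>
  Proportional normalised vectors are equal, because the coordinate that is \<open>1\<close> fixes the factor.
\<close>

lemma proj_points_eqI:
  fixes c k :: int
  assumes p: "prime p" and u: "u \<in> proj_points p" and u': "u' \<in> proj_points p"
    and c: "\<not> int p dvd c"
    and 1: "[c * fst u = k * fst u'] (mod int p)" and 2: "[c * snd u = k * snd u'] (mod int p)"
  shows "u = u'"
proof -
  have pp: "prime (int p)"
    using p by simp
  show ?thesis
  proof (rule proj_points_cases[OF u])
    assume uinf: "u = (0, 1)"
    show ?thesis
    proof (rule proj_points_cases[OF u'])
      fix t assume "u' = (1, t)"
      with uinf 1 2 have "[0 = k] (mod int p)" "[c = k * t] (mod int p)"
        by simp_all
      then have "[c = 0] (mod int p)"
        by (metis cong_scalar_right cong_sym cong_trans mult_zero_left)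
      with c show ?thesis
        by (simp add: cong_0_iff)
    qed (simp add: uinf)
  next
    fix t assume ufin: "u = (1, t)" "0 \<le> t" "t < int p"
    show ?thesis
    proof (rule proj_points_cases[OF u'])
      assume "u' = (0, 1)"
      with ufin 1 c show ?thesis
        by (simp add: cong_0_iff)
    next
      fix t' assume u't: "u' = (1, t')" "0 \<le> t'" "t' < int p"
      have "[c * t = k * t'] (mod int p)" "[c = k] (mod int p)"
        using 1 2 u't ufin by simp_all
      then have "[c * t = c * t'] (mod int p)"
        by (metis cong_scalar_right cong_sym cong_trans)
      then have "[t = t'] (mod int p)"
        using prime_imp_coprime[OF pp c] cong_mult_lcancel[of c "int p" t t'] by (simp add: coprime_commute)
      then show ?thesis
        using u't ufin by (simp add: cong_less_imp_eq_int)
    qed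
  qed
qed

text \<open>
  Stated with the operations of the module, so that it is the span of \<open>v\<close> by \<open>span_singleton\<close>.
\<close>

definition ray :: "nat \<Rightarrow> int \<times> int \<Rightarrow> (int \<times> int) set" where
  "ray p v = (\<lambda>k. k \<odot>\<^bsub>plane p\<^esub> v) ` carrier (residue_ring (int p))"

lemma ray_eq:
  "ray p v = (\<lambda>k. ((k * fst v) mod int p, (k * snd v) mod int p)) ` {0..<int p}"
  by (auto simp: ray_def plane_def residue_ring_def split_def image_iff)

lemma (in module) span_singleton:
  assumes "v \<in> carrier M"
  shows "span {v} = (\<lambda>k. k \<odot>\<^bsub>M\<^esub> v) ` carrier R"
proof -
  have "span {v} = {lincomb a {v} | a. a \<in> {v} \<rightarrow> carrier R}"
    using assms by (intro finite_span) auto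
  also have "\<dots> = {a v \<odot>\<^bsub>M\<^esub> v | a. a \<in> {v} \<rightarrow> carrier R}"
  proof -
    have "lincomb a {v} = a v \<odot>\<^bsub>M\<^esub> v" if "a \<in> {v} \<rightarrow> carrier R" for a
      using that assms M.finsum_insert[of "{}" v "\<lambda>v. a v \<odot>\<^bsub>M\<^esub> v"] by (auto simp: lincomb_def)
    then show ?thesis
      by (intro Collect_cong ex_cong1) auto
  qed
  also have "\<dots> = (\<lambda>k. k \<odot>\<^bsub>M\<^esub> v) ` carrier R"
    by (auto simp: image_iff intro!: exI[of _ "\<lambda>_. _"])
  finally show ?thesis .
qed

lemma ray_in_lines:
  assumes p: "prime p" and v: "v \<in> carrier (plane p)" "v \<noteq> (0, 0)"
  shows "ray p v \<in> lines p"
proof -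
  interpret V: vectorspace "residue_ring (int p)" "plane p"
    by (rule vectorspace_plane[OF p])
  have ray: "ray p v = V.span {v}"
    using V.span_singleton[OF v(1)] by (simp add: ray_def)
  have sub: "VectorSpace.subspace (residue_ring (int p)) (ray p v) (plane p)"
    unfolding ray by (rule V.span_is_subspace) (use v in auto)
  interpret W: vectorspace "residue_ring (int p)" "plane p\<lparr>carrier := ray p v\<rparr>"
    by (rule V.subspace_is_vs[OF sub])
  have mem: "v \<in> ray p v"
    unfolding ray using v(1) V.in_own_span[of "{v}"] by auto
  have "W.dim = 1"
  proof (rule W.dim1I)
    show "W.span {v} = carrier (plane p\<lparr>carrier := ray p v\<rparr>)"
      using W.span_singleton[of v] mem by (simp add: ray_def)
    show "v \<noteq> \<zero>\<^bsub>plane p\<lparr>carrier := ray p v\<rparr>\<^esub>"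
      using v(2) by (simp add: plane_def)
  qed (simp add: mem)
  with sub show ?thesis
    by (simp add: lines_def)
qed

text \<open>
  A subspace of dimension one is finite, hence has a finite basis; this basis has a single element,
  which is nonzero because it is linearly independent.
\<close>

lemma lines_are_rays:
  assumes p: "prime p" and L: "L \<in> lines p"
  obtains v where "v \<in> carrier (plane p)" "v \<noteq> (0, 0)" "L = ray p v"
proof -
  interpret V: vectorspace "residue_ring (int p)" "plane p"
    by (rule vectorspace_plane[OF p])
  have sub: "VectorSpace.subspace (residue_ring (int p)) L (plane p)"
    using L by (simp add: lines_def)
  interpret W: vectorspace "residue_ring (int p)" "plane p\<lparr>carrier := L\<rparr>"
    by (rule V.subspace_is_vs[OF sub])
  have LV: "L \<subseteq> carrier (plane p)"
    using sub by (simp add: VectorSpace.subspace_def LinearCombinations.submodule_def)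
  have "finite (carrier (plane p))"
    by (simp add: plane_def)
  then have "finite L"
    using LV finite_subset by blast
  moreover have "W.span L = L"
    using W.span_is_subset2[of L] W.in_own_span[of L] by simp
  ultimately have "W.fin_dim"
    unfolding W.fin_dim_def by (intro exI[of _ L]) simp
  then obtain B where B: "finite B" "W.basis B"
    using W.finite_basis_exists by blast
  then have "card B = 1"
    using W.dim_basis[of B] L by (simp add: lines_def)
  then obtain v where v: "B = {v}"
    by (rule card_1_singletonE)
  with B have vL: "v \<in> L" and gen: "W.span {v} = L" and indep: "W.lin_indpt {v}"
    by (auto simp: W.basis_def)
  show ?thesis
  proof (rule that)
    show "v \<in> carrier (plane p)"
      using vL LV by auto
    show "v \<noteq> (0, 0)"
    proof
      assume "v = (0, 0)"
      then have "\<zero>\<^bsub>plane p\<lparr>carrier := L\<rparr>\<^esub> \<in> {v}"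
        by (simp add: plane_def)
      with W.vs_zero_lin_dep[of "{v}"] indep vL show False
        by simp
    qed
    show "L = ray p v"
      using gen W.span_singleton[of v] vL by (simp add: ray_def)
  qed
qed

lemma ray_scale:
  assumes p: "prime p" and c: "\<not> int p dvd c"
    and 1: "[fst v = c * fst u] (mod int p)" and 2: "[snd v = c * snd u] (mod int p)"
  shows "ray p v = ray p u"
proof -
  have pos: "int p > 0"
    using p prime_gt_0_nat by simp
  have sub: "ray p v \<subseteq> ray p u"
    if 1: "[fst v = c * fst u] (mod int p)" and 2: "[snd v = c * snd u] (mod int p)" for u v c
  proof
    fix w assume "w \<in> ray p v"
    then obtain k where k: "w = ((k * fst v) mod int p, (k * snd v) mod int p)"
      by (auto simp: ray_eq)
    have "w = (((k * c) mod int p * fst u) mod int p, ((k * c) mod int p * snd u) mod int p)"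
      using cong_scalar_left[OF 1, of k] cong_scalar_left[OF 2, of k]
      by (simp add: k cong_def mod_simps mult.assoc)
    then show "w \<in> ray p u"
      using pos by (auto simp: ray_eq)
  qed
  obtain d where d: "[c * d = 1] (mod int p)"
    using inverse_mod_prime[OF p c] by blast
  have inv: "[x = d * y] (mod int p)" if "[y = c * x] (mod int p)" for x y
  proof -
    have "[d * y = d * (c * x)] (mod int p)"
      using that by (rule cong_scalar_left)
    also have "d * (c * x) = (c * d) * x"
      by simp
    also have "[\<dots> = 1 * x] (mod int p)"
      using d by (rule cong_scalar_right)
    finally show ?thesis
      by (simp add: cong_sym)
  qed
  show ?thesis
    using sub[OF 1 2] sub[OF inv[OF 1] inv[OF 2]] by (rule equalityI)
qed

lemma bij_betw_ray:
  assumes p: "prime p"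
  shows "bij_betw (ray p) (proj_points p) (lines p)"
proof (rule bij_betw_imageI)
  have p1: "int p > 1"
    using p prime_gt_1_nat by simp
  have points: "u \<in> carrier (plane p) \<and> u \<noteq> (0, 0)" if "u \<in> proj_points p" for u
    using that p1 by (auto simp: proj_points_def plane_def)
  show "inj_on (ray p) (proj_points p)"
  proof (rule inj_onI)
    fix u u' assume u: "u \<in> proj_points p" and u': "u' \<in> proj_points p" and eq: "ray p u = ray p u'"
    have "u = ((1 * fst u) mod int p, (1 * snd u) mod int p)"
      using points[OF u] by (auto simp: plane_def)
    then have "u \<in> ray p u"
      unfolding ray_eq using p1 by (intro image_eqI[of _ _ 1]) simp_all
    then obtain k where "u = ((k * fst u') mod int p, (k * snd u') mod int p)"
      unfolding eq by (auto simp: ray_eq)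
    then have "[1 * fst u = k * fst u'] (mod int p)" "[1 * snd u = k * snd u'] (mod int p)"
      by (metis cong_mod_left cong_refl fst_conv mult_1, metis cong_mod_left cong_refl snd_conv mult_1)
    with p1 show "u = u'"
      by (intro proj_points_eqI[OF p u u', of 1 k]) auto
  qed
  show "ray p ` proj_points p = lines p"
  proof (intro equalityI subsetI)
    fix L assume "L \<in> lines p"
    then obtain v where v: "v \<in> carrier (plane p)" "v \<noteq> (0, 0)" "L = ray p v"
      by (rule lines_are_rays[OF p])
    then have "\<not> (int p dvd fst v \<and> int p dvd snd v)"
      by (auto simp: plane_def dest: zdvd_imp_le)
    then obtain u c where u: "u \<in> proj_points p" "c \<in> {1..<int p}"
        "[fst v = c * fst u] (mod int p)" "[snd v = c * snd u] (mod int p)"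
      by (rule proj_points_representative[OF p])
    then have "\<not> int p dvd c"
      by (auto dest: zdvd_imp_le)
    from ray_scale[OF p this u(3,4)] u(1) v(3) show "L \<in> ray p ` proj_points p"
      by auto
  qed (use points ray_in_lines[OF p] in auto)
qed

lemma card_lines:
  assumes "prime p"
  shows "card (lines p) = Suc p"
  using bij_betw_same_card[OF bij_betw_ray[OF assms]] by (simp add: card_proj_points)

section \<open>Quaternions modulo p as two-by-two matrices\<close>

text \<open>
  Pigeonhole: \<open>a\<^sup>2\<close> and \<open>- 1 - b\<^sup>2\<close> each take \<open>(p + 1) / 2\<close> different values modulo \<open>p\<close> when \<open>a\<close> and \<open>b\<close>
  run through \<open>0, \<dots>, (p - 1) / 2\<close>, so they have a value in common.
\<close>

lemma sum_two_squares_minus_one_mod_prime: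
  assumes p: "prime p" and "odd p"
  obtains a b :: int where "int p dvd a * a + b * b + 1"
proof -
  let ?m = "(int p - 1) div 2"
  let ?R = "{0..?m}" and ?f = "\<lambda>a :: int. (a * a) mod int p" and ?g = "\<lambda>b :: int. (- 1 - b * b) mod int p"
  have p3: "int p \<ge> 3"
    using assms prime_ge_2_nat[OF p] by (cases "p = 2") auto
  have m: "2 * ?m + 1 = int p"
    using \<open>odd p\<close> by (auto elim!: oddE)
  have square_inj: "x = y" if "x \<in> ?R" "y \<in> ?R" "int p dvd x * x - y * y" for x y
  proof -
    have "int p dvd (x - y) * (x + y)"
      using that(3) by (simp add: algebra_simps)
    then consider "int p dvd x - y" | "int p dvd x + y"
      using p prime_dvd_mult_iff[of "int p"] by auto
    then show ?thesis
    proof cases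
      case 1
      then have "x - y = 0"
        using that(1,2) m p3 dvd_imp_le_int[of "x - y" "int p"] by (cases "x = y") auto
      then show ?thesis by simp
    next
      case 2
      then have "x + y = 0"
        using that m p3 by (auto dest: zdvd_imp_le simp: order_le_less)
      then show ?thesis
        using that by auto
    qed
  qed
  have inj: "inj_on ?f ?R" "inj_on ?g ?R"
  proof -
    show "inj_on ?f ?R"
      by (rule inj_onI) (rule square_inj, auto simp: mod_eq_dvd_iff)
    show "inj_on ?g ?R"
    proof (rule inj_onI)
      fix x y assume xy: "x \<in> ?R" "y \<in> ?R" "?g x = ?g y"
      then have "int p dvd y * y - x * x"
        by (simp add: mod_eq_dvd_iff)
      with square_inj[of y x] xy show "x = y"
        by auto
    qed
  qed
  have "?f ` ?R \<inter> ?g ` ?R \<noteq> {}"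
  proof
    assume disj: "?f ` ?R \<inter> ?g ` ?R = {}"
    have "card (?f ` ?R \<union> ?g ` ?R) = card ?R + card ?R"
      using disj inj by (simp add: card_Un_disjoint card_image)
    moreover have "card (?f ` ?R \<union> ?g ` ?R) \<le> card {0..<int p}"
      using p3 by (intro card_mono) auto
    ultimately show False
      using m p3 by simp
  qed
  then obtain a b where "?f a = ?g b"
    by auto
  then have "int p dvd a * a - (- 1 - b * b)"
    by (simp add: mod_eq_dvd_iff)
  then show ?thesis
    by (intro that[of a b]) (simp add: algebra_simps)
qed

type_synonym quadruple = "int \<times> int \<times> int \<times> int"

text \<open>
  A two-by-two matrix is represented by its entries, row by row. When \<open>a\<^sup>2 + b\<^sup>2 = -1\<close>, the
  matrices with rows \<open>(a, b), (b, -a)\<close> and \<open>(0, -1), (1, 0)\<close> satisfy the relations of \<open>i\<close> and \<open>j\<close>, with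
  product \<open>k\<close> having rows \<open>(b, -a), (-a, -b)\<close>; this is the linear extension. All entries are integers, and equations
  are replaced by congruences modulo \<open>p\<close>.
\<close>

fun mat_of_quat :: "int \<Rightarrow> int \<Rightarrow> quadruple \<Rightarrow> quadruple" where
  "mat_of_quat a b (x, y, z, w) =
    (x + a * y + b * w, b * y - z - a * w, b * y + z - a * w, x - a * y - b * w)"

fun mat_mult :: "quadruple \<Rightarrow> quadruple \<Rightarrow> quadruple" where
  "mat_mult (x, y, z, w) (x', y', z', w') =
    (x * x' + y * z', x * y' + y * w', z * x' + w * z', z * y' + w * w')"

fun cong4 :: "int \<Rightarrow> quadruple \<Rightarrow> quadruple \<Rightarrow> bool" where
  "cong4 n (x, y, z, w) (x', y', z', w') \<longleftrightarrow>
    [x = x'] (mod n) \<and> [y = y'] (mod n) \<and> [z = z'] (mod n) \<and> [w = w'] (mod n)"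

text \<open>
  The matrix \<open>c u v\<^sup>T\<close>.
\<close>

fun outer :: "int \<Rightarrow> int \<times> int \<Rightarrow> int \<times> int \<Rightarrow> quadruple" where
  "outer c (u1, u2) (v1, v2) = (c * u1 * v1, c * u1 * v2, c * u2 * v1, c * u2 * v2)"

lemma cong4_sym: "cong4 n x y \<Longrightarrow> cong4 n y x"
  by (cases x; cases y) (auto intro: cong_sym)

lemma cong4_trans: "cong4 n x y \<Longrightarrow> cong4 n y z \<Longrightarrow> cong4 n x z"
  by (cases x; cases y; cases z) (auto intro: cong_trans)

lemma cong4_mat_mult:
  assumes "cong4 n x x'" and "cong4 n y y'"
  shows "cong4 n (mat_mult x y) (mat_mult x' y')"
  using assms by (cases x; cases x'; cases y; cases y') (auto intro!: cong_add cong_mult)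

text \<open>
  Multiplication of quaternions over the integers, before reduction modulo \<open>p\<close>.
\<close>

fun quat_mult :: "quadruple \<Rightarrow> quadruple \<Rightarrow> quadruple" where
  "quat_mult (a, b, c, d) (a', b', c', d') =
    (a * a' - b * b' - c * c' - d * d', a * b' + b * a' + c * d' - d * c',
     a * c' - b * d' + c * a' + d * b', a * d' + b * c' - c * b' + d * a')"

lemma lipschitz_mult_cong: "cong4 (int p) (x \<otimes>\<^bsub>lipschitz_ring p\<^esub> y) (quat_mult x y)"
  by (cases x; cases y) (simp add: lipschitz_ring_def)

lemma cong4_mat_of_quat:
  assumes "cong4 n x y"
  shows "cong4 n (mat_of_quat a b x) (mat_of_quat a b y)"
  using assms by (cases x; cases y) (auto intro!: cong_add cong_diff cong_mult)

text \<open>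
  Before reduction modulo \<open>p\<close>, the two sides differ by multiples of \<open>a\<^sup>2 + b\<^sup>2 + 1\<close>.
\<close>

lemma mat_of_quat_mult:
  assumes "int p dvd a * a + b * b + 1"
  shows "cong4 (int p) (mat_of_quat a b (x \<otimes>\<^bsub>lipschitz_ring p\<^esub> y))
    (mat_mult (mat_of_quat a b x) (mat_of_quat a b y))"
proof -
  obtain x0 x1 x2 x3 y0 y1 y2 y3 where xy: "x = (x0, x1, x2, x3)" "y = (y0, y1, y2, y3)"
    by (cases x; cases y)
  have "cong4 (int p) (mat_of_quat a b (quat_mult x y)) (mat_mult (mat_of_quat a b x) (mat_of_quat a b y))"
    unfolding xy quat_mult.simps mat_of_quat.simps mat_mult.simps cong4.simps cong_iff_dvd_diff
    by (intro conjI; insert assms; Groebner_Basis.algebra)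
  then show ?thesis
    using cong4_mat_of_quat[OF lipschitz_mult_cong] cong4_trans by blast
qed

text \<open>
  The inverse of \<^const>\<open>mat_of_quat\<close> modulo \<open>p\<close>, where \<open>h\<close> is an inverse of \<open>2\<close>.
\<close>

fun quat_of_mat :: "int \<Rightarrow> int \<Rightarrow> int \<Rightarrow> quadruple \<Rightarrow> quadruple" where
  "quat_of_mat a b h (x, y, z, w) =
    (h * (x + w), - h * (a * (x - w) + b * (y + z)), h * (z - y), - h * (b * (x - w) - a * (y + z)))"

fun mod4 :: "int \<Rightarrow> quadruple \<Rightarrow> quadruple" where
  "mod4 n (x, y, z, w) = (x mod n, y mod n, z mod n, w mod n)"

lemma cong4_mod4 [simp]: "cong4 n (mod4 n x) x"
  by (cases x) simp

lemma mat_of_quat_of_mat: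
  assumes "n dvd a * a + b * b + 1" and "n dvd 2 * h - 1"
  shows "cong4 n (mat_of_quat a b (quat_of_mat a b h m)) m"
proof -
  obtain m0 m1 m2 m3 where m: "m = (m0, m1, m2, m3)"
    by (cases m)
  show ?thesis
    unfolding m quat_of_mat.simps mat_of_quat.simps cong4.simps cong_iff_dvd_diff
    by (intro conjI; insert assms; Groebner_Basis.algebra)
qed

lemma quat_of_mat_of_quat:
  assumes "n dvd a * a + b * b + 1" and "n dvd 2 * h - 1"
  shows "cong4 n (quat_of_mat a b h (mat_of_quat a b x)) x"
proof -
  obtain x0 x1 x2 x3 where x: "x = (x0, x1, x2, x3)"
    by (cases x)
  show ?thesis
    unfolding x quat_of_mat.simps mat_of_quat.simps cong4.simps cong_iff_dvd_diff
    by (intro conjI; insert assms; Groebner_Basis.algebra)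
qed

lemma cong4_quat_of_mat:
  assumes "cong4 n x y"
  shows "cong4 n (quat_of_mat a b h x) (quat_of_mat a b h y)"
  using assms by (cases x; cases y) (auto intro!: cong_add cong_diff cong_mult simp: cong_minus_minus_iff)

section \<open>Zero divisors, their kernels and their images\<close>

lemma cong4_left_iff: "cong4 n x y \<Longrightarrow> cong4 n x z \<longleftrightarrow> cong4 n y z"
  using cong4_sym cong4_trans by blast

text \<open>
  Multiply the system by the adjugate matrix.
\<close>

lemma cramer_dvd:
  fixes n :: int
  assumes "n dvd m11 * x + m12 * y" and "n dvd m21 * x + m22 * y"
  shows "n dvd (m11 * m22 - m12 * m21) * x" and "n dvd (m11 * m22 - m12 * m21) * y"
  using assms by Groebner_Basis.algebra+

lemma outer_cong_zero_iff:
  assumes "u \<in> proj_points p" and "v \<in> proj_points p"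
  shows "cong4 (int p) (outer c u v) (0, 0, 0, 0) \<longleftrightarrow> int p dvd c"
  by (rule proj_points_cases[OF assms(1)]; rule proj_points_cases[OF assms(2)])
    (auto simp: cong_0_iff)

lemma mat_mult_outer:
  "mat_mult (outer c u v) (outer c' u' v') = outer (c * c' * (fst v * fst u' + snd v * snd u')) u v'"
  by (cases u; cases v; cases u'; cases v') (simp add: algebra_simps)

lemma not_dvd_unit_range: "c \<in> {1..<int p} \<Longrightarrow> \<not> int p dvd c"
  by (auto dest: zdvd_imp_le)

text \<open>
  Choosing a coordinate where \<open>v\<close> is \<open>1\<close> exhibits \<open>u\<close> and \<open>u'\<close> as proportional, hence equal; likewise for
  \<open>v\<close> and \<open>v'\<close>. An entry where both \<open>u\<close> and \<open>v\<close> are \<open>1\<close> then compares the scalars.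
\<close>

lemma outer_inj:
  assumes p: "prime p" and u: "u \<in> proj_points p" "u' \<in> proj_points p"
    and v: "v \<in> proj_points p" "v' \<in> proj_points p"
    and c: "c \<in> {1..<int p}" "c' \<in> {1..<int p}"
    and eq: "cong4 (int p) (outer c u v) (outer c' u' v')"
  shows "u = u' \<and> v = v' \<and> c = c'"
proof -
  obtain u1 u2 v1 v2 u1' u2' v1' v2' where uv: "u = (u1, u2)" "v = (v1, v2)" "u' = (u1', u2')" "v' = (v1', v2')"
    by (cases u; cases v; cases u'; cases v')
  have eqs: "[c * u1 * v1 = c' * u1' * v1'] (mod int p)" "[c * u1 * v2 = c' * u1' * v2'] (mod int p)"
    "[c * u2 * v1 = c' * u2' * v1'] (mod int p)" "[c * u2 * v2 = c' * u2' * v2'] (mod int p)"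
    using eq by (simp_all add: uv)
  note nd = not_dvd_unit_range[OF c(1)]
  have unit: "fst w = 1 \<or> snd w = 1" if "w \<in> proj_points p" for w
    using that by (auto simp: proj_points_def)
  have "v1 = 1 \<or> v2 = 1"
    using unit[OF v(1)] by (simp add: uv)
  then have uu: "u = u'"
  proof
    assume "v1 = 1"
    then show ?thesis
      using eqs(1,3) by (intro proj_points_eqI[OF p u nd, of "c' * v1'"]) (simp_all add: uv mult_ac)
  next
    assume "v2 = 1"
    then show ?thesis
      using eqs(2,4) by (intro proj_points_eqI[OF p u nd, of "c' * v2'"]) (simp_all add: uv mult_ac)
  qed
  have "u1 = 1 \<or> u2 = 1"
    using unit[OF u(1)] by (simp add: uv)
  then have vv: "v = v'"
  proof
    assume "u1 = 1"
    then show ?thesis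
      using eqs(1,2) by (intro proj_points_eqI[OF p v nd, of "c' * u1'"]) (simp_all add: uv mult_ac)
  next
    assume "u2 = 1"
    then show ?thesis
      using eqs(3,4) by (intro proj_points_eqI[OF p v nd, of "c' * u2'"]) (simp_all add: uv mult_ac)
  qed
  have "[c = c'] (mod int p)"
    using uu vv eqs unit[OF u(1)] unit[OF v(1)] by (auto simp: uv)
  then have "c = c'"
    using c cong_less_imp_eq_int[of c "int p" c'] by auto
  with uu vv show ?thesis
    by simp
qed

text \<open>
  If the first row is nonzero, it is a multiple of some normalised \<open>v\<close>, and the vanishing determinant
  makes the second row another multiple; the two factors, normalised, give \<open>u\<close>. If the first row is
  zero, \<open>u = (0, 1)\<close> does.
\<close>

lemma singular_mat_is_outer:
  assumes p: "prime p" and nz: "\<not> cong4 (int p) (m11, m12, m21, m22) (0, 0, 0, 0)"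
    and det: "int p dvd m11 * m22 - m12 * m21"
  obtains u v c where "u \<in> proj_points p" "v \<in> proj_points p" "c \<in> {1..<int p}"
    "cong4 (int p) (m11, m12, m21, m22) (outer c u v)"
proof -
  have combine: "[x = c * s * t] (mod int p)" if "[x = k * t] (mod int p)" "[k = c * s] (mod int p)" for x k t c s
    using that by (metis cong_scalar_right cong_trans)
  show ?thesis
  proof (cases "int p dvd m11 \<and> int p dvd m12")
    case True
    with nz have "\<not> (int p dvd m21 \<and> int p dvd m22)"
      by (simp add: cong_0_iff)
    then obtain v c where "v \<in> proj_points p" "c \<in> {1..<int p}"
        "[m21 = c * fst v] (mod int p)" "[m22 = c * snd v] (mod int p)"
      by (rule proj_points_representative[OF p])
    then show ?thesis
      using True by (intro that[of "(0, 1)" v c]) (cases v; auto simp: proj_points_def cong_0_iff)+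
  next
    case False
    then obtain v c where v: "v \<in> proj_points p" "c \<in> {1..<int p}"
        "[m11 = c * fst v] (mod int p)" "[m12 = c * snd v] (mod int p)"
      by (rule proj_points_representative[OF p])
    have "int p dvd c * (fst v * m22 - snd v * m21)"
      using det v(3,4) unfolding cong_iff_dvd_diff by Groebner_Basis.algebra
    then have par: "int p dvd fst v * m22 - snd v * m21"
      using not_dvd_unit_range[OF v(2)] p by (simp add: prime_dvd_mult_iff)
    obtain k where k: "[m21 = k * fst v] (mod int p)" "[m22 = k * snd v] (mod int p)"
    proof (rule proj_points_cases[OF v(1)])
      assume "v = (0, 1)"
      then show thesis
        using that[of m22] par by (simp add: cong_0_iff)
    next
      fix t assume "v = (1, t)"
      then show thesis
        using that[of m21] par by (simp add: cong_iff_dvd_diff mult.commute)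
    qed
    obtain u d where u: "u \<in> proj_points p" "d \<in> {1..<int p}"
        "[c = d * fst u] (mod int p)" "[k = d * snd u] (mod int p)"
      by (rule proj_points_representative[OF p, of c k]) (use not_dvd_unit_range[OF v(2)] in auto)
    show ?thesis
      by (rule that[OF u(1) v(1) u(2)])
        (use combine[OF v(3) u(3)] combine[OF v(4) u(3)] combine[OF k(1) u(4)] combine[OF k(2) u(4)] in
          \<open>cases u; cases v; simp\<close>)
  qed
qed

definition orthogonal :: "nat \<Rightarrow> int \<times> int \<Rightarrow> int \<times> int \<Rightarrow> bool" where
  "orthogonal p u v \<longleftrightarrow> int p dvd fst u * fst v + snd u * snd v"

lemma orthogonal_sym: "orthogonal p u v \<longleftrightarrow> orthogonal p v u"
  by (simp add: orthogonal_def mult.commute)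

text \<open>
  The vectors orthogonal to \<open>u = (u\<^sub>1, u\<^sub>2)\<close> are the multiples of \<open>(- u\<^sub>2, u\<^sub>1)\<close>.
\<close>

lemma ex1_orthogonal:
  assumes p: "prime p" and u: "u \<in> proj_points p"
  shows "\<exists>!v. v \<in> proj_points p \<and> orthogonal p u v"
proof -
  have pp: "prime (int p)"
    using p by simp
  have "\<not> (int p dvd - snd u \<and> int p dvd fst u)"
    using u pp by (auto simp: proj_points_def)
  then obtain v c where v: "v \<in> proj_points p" "c \<in> {1..<int p}"
      "[- snd u = c * fst v] (mod int p)" "[fst u = c * snd v] (mod int p)"
    by (rule proj_points_representative[OF p])
  have "int p dvd c * (fst u * fst v + snd u * snd v)"
    using v(3,4) unfolding cong_iff_dvd_diff by Groebner_Basis.algebra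
  then have orth: "orthogonal p u v"
    using not_dvd_unit_range[OF v(2)] pp by (simp add: orthogonal_def prime_dvd_mult_iff)
  have "w = v" if w: "w \<in> proj_points p" "orthogonal p u w" for w
  proof -
    \<comment> \<open>The coordinate of \<open>u\<close> that equals \<open>1\<close> tells which coordinate of \<open>w\<close> gives \<open>k\<close>, up to sign.\<close>
    have "\<exists>k. [fst w = - snd u * k] (mod int p) \<and> [snd w = fst u * k] (mod int p)"
    proof (rule proj_points_cases[OF u])
      assume "u = (0, 1)"
      then show ?thesis
        using w(2) by (intro exI[of _ "- fst w"]) (simp add: orthogonal_def cong_0_iff)
    next
      fix t assume "u = (1, t)"
      then show ?thesis
        using w(2) by (intro exI[of _ "snd w"]) (simp add: orthogonal_def cong_iff_dvd_diff)
    qed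
    then obtain k where k: "[fst w = - snd u * k] (mod int p)" "[snd w = fst u * k] (mod int p)"
      by blast
    have "[1 * fst w = (c * k) * fst v] (mod int p)" "[1 * snd w = (c * k) * snd v] (mod int p)"
      using cong_trans[OF k(1) cong_scalar_right[OF v(3), of k]]
        cong_trans[OF k(2) cong_scalar_right[OF v(4), of k]] by (simp_all add: mult_ac)
    then show ?thesis
      using pp by (intro proj_points_eqI[OF p w(1) v(1), of 1]) auto
  qed
  with v(1) orth show ?thesis
    by blast
qed

definition perp :: "nat \<Rightarrow> int \<times> int \<Rightarrow> int \<times> int" where
  "perp p u = (THE v. v \<in> proj_points p \<and> orthogonal p u v)"

lemma perp_in_proj_points: "prime p \<Longrightarrow> u \<in> proj_points p \<Longrightarrow> perp p u \<in> proj_points p"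
  using theI'[OF ex1_orthogonal] by (simp add: perp_def)

lemma orthogonal_iff_perp:
  assumes "prime p" and "u \<in> proj_points p" and "v \<in> proj_points p"
  shows "orthogonal p u v \<longleftrightarrow> v = perp p u"
  using theI'[OF ex1_orthogonal[OF assms(1,2)]] ex1_orthogonal[OF assms(1,2)] assms(3)
  by (auto simp: perp_def)

lemma perp_perp:
  assumes "prime p" and "u \<in> proj_points p"
  shows "perp p (perp p u) = u"
  using assms perp_in_proj_points orthogonal_iff_perp orthogonal_sym by metis

lemma lipschitz_carrier_eqI:
  assumes "x \<in> carrier (lipschitz_ring p)" and "y \<in> carrier (lipschitz_ring p)" and "cong4 (int p) x y"
  shows "x = y"
  using assms by (cases x; cases y) (auto simp: lipschitz_ring_def cong_less_imp_eq_int)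

lemma lipschitz_mult_closed:
  assumes "p > 0"
  shows "x \<otimes>\<^bsub>lipschitz_ring p\<^esub> y \<in> carrier (lipschitz_ring p)"
  using assms by (cases x; cases y) (simp add: lipschitz_ring_def)

text \<open>
  The data of an isomorphism from the Lipschitz quaternions modulo \<open>p\<close> to the two-by-two matrices;
  they exist for every odd prime \<open>p\<close>.
\<close>

locale lipschitz_splitting =
  fixes p :: nat and a b h :: int
  assumes prime: "prime p"
    and minus_one: "int p dvd a * a + b * b + 1"
    and half: "int p dvd 2 * h - 1"
begin

abbreviation "R \<equiv> lipschitz_ring p"
abbreviation "\<Phi> \<equiv> mat_of_quat a b"

definition rank_one :: "int \<times> int \<Rightarrow> int \<times> int \<Rightarrow> int \<Rightarrow> quadruple" where
  "rank_one u v c = mod4 (int p) (quat_of_mat a b h (outer c u v))"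

lemma pos: "int p > 0"
  using prime prime_gt_0_nat by simp

lemma rank_one_carrier: "rank_one u v c \<in> carrier R"
  using pos by (cases "quat_of_mat a b h (outer c u v)") (simp add: rank_one_def lipschitz_ring_def)

lemma mat_of_rank_one: "cong4 (int p) (\<Phi> (rank_one u v c)) (outer c u v)"
  unfolding rank_one_def
  by (rule cong4_trans[OF cong4_mat_of_quat[OF cong4_mod4] mat_of_quat_of_mat[OF minus_one half]])

lemma mat_of_quat_inj:
  assumes "x \<in> carrier R" and "y \<in> carrier R" and "cong4 (int p) (\<Phi> x) (\<Phi> y)"
  shows "x = y"
proof (rule lipschitz_carrier_eqI[OF assms(1,2)])
  have "cong4 (int p) x (quat_of_mat a b h (\<Phi> x))"
    by (rule cong4_sym[OF quat_of_mat_of_quat[OF minus_one half]])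
  then have "cong4 (int p) x (quat_of_mat a b h (\<Phi> y))"
    by (rule cong4_trans[OF _ cong4_quat_of_mat[OF assms(3)]])
  then show "cong4 (int p) x y"
    by (rule cong4_trans[OF _ quat_of_mat_of_quat[OF minus_one half]])
qed

lemma eq_zero_iff:
  assumes "x \<in> carrier R"
  shows "x = \<zero>\<^bsub>R\<^esub> \<longleftrightarrow> cong4 (int p) (\<Phi> x) (0, 0, 0, 0)"
proof
  assume "cong4 (int p) (\<Phi> x) (0, 0, 0, 0)"
  moreover have "\<Phi> \<zero>\<^bsub>R\<^esub> = (0, 0, 0, 0)" "\<zero>\<^bsub>R\<^esub> \<in> carrier R"
    using pos by (simp_all add: lipschitz_ring_def)
  ultimately show "x = \<zero>\<^bsub>R\<^esub>"
    using mat_of_quat_inj[OF assms] by metis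
qed (simp add: lipschitz_ring_def)

lemma mult_eq_zero_iff:
  "x \<otimes>\<^bsub>R\<^esub> y = \<zero>\<^bsub>R\<^esub> \<longleftrightarrow> cong4 (int p) (mat_mult (\<Phi> x) (\<Phi> y)) (0, 0, 0, 0)"
  using pos by (subst eq_zero_iff[OF lipschitz_mult_closed])
    (simp_all add: cong4_left_iff[OF mat_of_quat_mult[OF minus_one]])

lemma rank_one_nonzero:
  assumes "u \<in> proj_points p" "v \<in> proj_points p" "c \<in> {1..<int p}"
  shows "rank_one u v c \<noteq> \<zero>\<^bsub>R\<^esub>"
  unfolding eq_zero_iff[OF rank_one_carrier] cong4_left_iff[OF mat_of_rank_one]
    outer_cong_zero_iff[OF assms(1,2)] by (rule not_dvd_unit_range[OF assms(3)])

text \<open>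
  The product of \<open>c u v\<^sup>T\<close> and \<open>c' u' v'\<^sup>T\<close> is \<open>c c' (v \<bullet> u') u v'\<^sup>T\<close>.
\<close>

lemma rank_one_mult_eq_zero_iff:
  assumes "u \<in> proj_points p" "v \<in> proj_points p" "c \<in> {1..<int p}"
    and "u' \<in> proj_points p" "v' \<in> proj_points p" "c' \<in> {1..<int p}"
  shows "rank_one u v c \<otimes>\<^bsub>R\<^esub> rank_one u' v' c' = \<zero>\<^bsub>R\<^esub> \<longleftrightarrow> u' = perp p v"
proof -
  have pp: "prime (int p)"
    using prime by simp
  have "cong4 (int p) (mat_mult (\<Phi> (rank_one u v c)) (\<Phi> (rank_one u' v' c')))
      (outer (c * c' * (fst v * fst u' + snd v * snd u')) u v')"
    using cong4_mat_mult[OF mat_of_rank_one mat_of_rank_one] by (simp add: mat_mult_outer)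
  then have "rank_one u v c \<otimes>\<^bsub>R\<^esub> rank_one u' v' c' = \<zero>\<^bsub>R\<^esub> \<longleftrightarrow>
      cong4 (int p) (outer (c * c' * (fst v * fst u' + snd v * snd u')) u v') (0, 0, 0, 0)"
    unfolding mult_eq_zero_iff using cong4_trans cong4_sym by blast
  also have "\<dots> \<longleftrightarrow> int p dvd c * c' * (fst v * fst u' + snd v * snd u')"
    by (rule outer_cong_zero_iff) (rule assms)+
  also have "\<dots> \<longleftrightarrow> orthogonal p v u'"
    using not_dvd_unit_range[OF assms(3)] not_dvd_unit_range[OF assms(6)] pp
    by (simp add: orthogonal_def prime_dvd_mult_iff)
  also have "\<dots> \<longleftrightarrow> u' = perp p v"
    by (rule orthogonal_iff_perp[OF prime]) (rule assms)+
  finally show ?thesis .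
qed

text \<open>
  Multiplying \<open>x y = 0\<close> from the left by the adjugate of \<open>x\<close> (or \<open>y x = 0\<close> from the right) gives
  \<open>det x \<cdot> y = 0\<close>, and \<open>y\<close> has an invertible entry.
\<close>

lemma singular_if_zero_divisor:
  assumes x: "x \<in> carrier R" and y: "y \<in> carrier R" "y \<noteq> \<zero>\<^bsub>R\<^esub>"
    and zero: "x \<otimes>\<^bsub>R\<^esub> y = \<zero>\<^bsub>R\<^esub> \<or> y \<otimes>\<^bsub>R\<^esub> x = \<zero>\<^bsub>R\<^esub>"
    and m: "\<Phi> x = (m11, m12, m21, m22)"
  shows "int p dvd m11 * m22 - m12 * m21"
proof -
  let ?d = "m11 * m22 - m12 * m21"
  obtain n11 n12 n21 n22 where n: "\<Phi> y = (n11, n12, n21, n22)"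
    by (cases "\<Phi> y")
  have "int p dvd ?d * n11 \<and> int p dvd ?d * n12 \<and> int p dvd ?d * n21 \<and> int p dvd ?d * n22"
    using zero
  proof
    assume "x \<otimes>\<^bsub>R\<^esub> y = \<zero>\<^bsub>R\<^esub>"
    then have "int p dvd m11 * n11 + m12 * n21" "int p dvd m11 * n12 + m12 * n22"
      "int p dvd m21 * n11 + m22 * n21" "int p dvd m21 * n12 + m22 * n22"
      unfolding mult_eq_zero_iff m n by (simp_all add: cong_0_iff)
    then show ?thesis
      using cramer_dvd by blast
  next
    assume "y \<otimes>\<^bsub>R\<^esub> x = \<zero>\<^bsub>R\<^esub>"
    then have "int p dvd m11 * n11 + m21 * n12" "int p dvd m12 * n11 + m22 * n12"
      "int p dvd m11 * n21 + m21 * n22" "int p dvd m12 * n21 + m22 * n22"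
      unfolding mult_eq_zero_iff m n by (simp_all add: cong_0_iff mult.commute)
    moreover have "?d = m11 * m22 - m21 * m12"
      by simp
    ultimately show ?thesis
      using cramer_dvd by metis
  qed
  moreover have "\<not> (int p dvd n11 \<and> int p dvd n12 \<and> int p dvd n21 \<and> int p dvd n22)"
    using y(2) eq_zero_iff[OF y(1)] by (simp add: n cong_0_iff)
  ultimately show ?thesis
    using prime by (auto simp: prime_dvd_mult_iff)
qed

text \<open>
  Zero divisors are nonzero singular matrices, and these are the \<open>c u v\<^sup>T\<close>. Conversely \<open>c u v\<^sup>T\<close> is
  annihilated from the right by every matrix of rank one whose image is orthogonal to \<open>v\<close>.
\<close>

lemma zero_divisors_eq:
  "zero_divisors R = (\<lambda>(u, v, c). rank_one u v c) ` (proj_points p \<times> proj_points p \<times> {1..<int p})"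
proof (intro equalityI subsetI)
  fix x assume "x \<in> zero_divisors R"
  then obtain y where x: "x \<in> carrier R" "x \<noteq> \<zero>\<^bsub>R\<^esub>" and y: "y \<in> carrier R" "y \<noteq> \<zero>\<^bsub>R\<^esub>"
      "x \<otimes>\<^bsub>R\<^esub> y = \<zero>\<^bsub>R\<^esub> \<or> y \<otimes>\<^bsub>R\<^esub> x = \<zero>\<^bsub>R\<^esub>"
    by (auto simp: zero_divisors_def)
  obtain m11 m12 m21 m22 where m: "\<Phi> x = (m11, m12, m21, m22)"
    by (cases "\<Phi> x")
  have "\<not> cong4 (int p) (m11, m12, m21, m22) (0, 0, 0, 0)"
    using eq_zero_iff[OF x(1)] x(2) m by simp
  then obtain u v c where uvc: "u \<in> proj_points p" "v \<in> proj_points p" "c \<in> {1..<int p}"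
      and "cong4 (int p) (m11, m12, m21, m22) (outer c u v)"
    using singular_mat_is_outer[OF prime] singular_if_zero_divisor[OF x(1) y m] by metis
  then have "x = rank_one u v c"
    by (intro mat_of_quat_inj[OF x(1) rank_one_carrier])
      (metis m cong4_trans cong4_sym mat_of_rank_one)
  with uvc show "x \<in> (\<lambda>(u, v, c). rank_one u v c) ` (proj_points p \<times> proj_points p \<times> {1..<int p})"
    by force
next
  fix x assume "x \<in> (\<lambda>(u, v, c). rank_one u v c) ` (proj_points p \<times> proj_points p \<times> {1..<int p})"
  then obtain u v c where uvc: "u \<in> proj_points p" "v \<in> proj_points p" "c \<in> {1..<int p}"
      and x: "x = rank_one u v c"
    by auto
  let ?y = "rank_one (perp p v) v c"
  have perp: "perp p v \<in> proj_points p"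
    by (rule perp_in_proj_points[OF prime uvc(2)])
  have "x \<otimes>\<^bsub>R\<^esub> ?y = \<zero>\<^bsub>R\<^esub>"
    unfolding x by (subst rank_one_mult_eq_zero_iff) (use uvc perp in auto)
  then show "x \<in> zero_divisors R"
    unfolding zero_divisors_def x
    using rank_one_carrier rank_one_nonzero[OF uvc] rank_one_nonzero[OF perp uvc(2,3)] by blast
qed

lemma rank_one_inj:
  assumes "u \<in> proj_points p" "v \<in> proj_points p" "c \<in> {1..<int p}"
    and "u' \<in> proj_points p" "v' \<in> proj_points p" "c' \<in> {1..<int p}"
    and "rank_one u v c = rank_one u' v' c'"
  shows "u = u' \<and> v = v' \<and> c = c'"
  by (rule outer_inj[OF prime])
    (use assms in \<open>auto intro: cong4_trans[OF cong4_sym[OF mat_of_rank_one]] simp: mat_of_rank_one\<close>)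

lemma inj_on_rank_one:
  "inj_on (\<lambda>(u, v, c). rank_one u v c) (proj_points p \<times> proj_points p \<times> {1..<int p})"
  using rank_one_inj by (auto intro!: inj_onI)

text \<open>
  Kernel and image of the matrix \<open>c u v\<^sup>T\<close>: it kills the vectors orthogonal to \<open>v\<close> and maps onto the multiples of \<open>u\<close>.
\<close>

definition zero_divisor_type :: "quadruple \<Rightarrow> (int \<times> int) set \<times> (int \<times> int) set" where
  "zero_divisor_type x =
    (case the_inv_into (proj_points p \<times> proj_points p \<times> {1..<int p}) (\<lambda>(u, v, c). rank_one u v c) x
     of (u, v, c) \<Rightarrow> (ray p (perp p v), ray p u))"

lemma zero_divisor_type_rank_one:
  assumes "u \<in> proj_points p" "v \<in> proj_points p" "c \<in> {1..<int p}"
  shows "zero_divisor_type (rank_one u v c) = (ray p (perp p v), ray p u)"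
  using the_inv_into_f_f[OF inj_on_rank_one, of "(u, v, c)"] assms
  by (simp add: zero_divisor_type_def)

lemma zero_divisorE:
  assumes "x \<in> zero_divisors R"
  obtains u v c where "u \<in> proj_points p" "v \<in> proj_points p" "c \<in> {1..<int p}" "x = rank_one u v c"
  using assms unfolding zero_divisors_eq by auto

lemma zero_divisor_type_in_lines:
  assumes "x \<in> zero_divisors R"
  shows "zero_divisor_type x \<in> lines p \<times> lines p"
  using assms
proof (rule zero_divisorE)
  fix u v c assume uvc: "u \<in> proj_points p" "v \<in> proj_points p" "c \<in> {1..<int p}" "x = rank_one u v c"
  then show ?thesis
    using bij_betwE[OF bij_betw_ray[OF prime]] perp_in_proj_points[OF prime]
    by (simp add: zero_divisor_type_rank_one)
qed

lemma ray_eq_iff: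
  assumes "u \<in> proj_points p" "v \<in> proj_points p"
  shows "ray p u = ray p v \<longleftrightarrow> u = v"
  using bij_betw_ray[OF prime] assms by (auto simp: bij_betw_def inj_on_def)

lemma mult_eq_zero_iff_type:
  assumes "x \<in> zero_divisors R" and "y \<in> zero_divisors R"
  shows "x \<otimes>\<^bsub>R\<^esub> y = \<zero>\<^bsub>R\<^esub> \<longleftrightarrow> snd (zero_divisor_type y) = fst (zero_divisor_type x)"
proof -
  obtain u v c where x: "u \<in> proj_points p" "v \<in> proj_points p" "c \<in> {1..<int p}" "x = rank_one u v c"
    using assms(1) by (rule zero_divisorE)
  obtain u' v' c' where y: "u' \<in> proj_points p" "v' \<in> proj_points p" "c' \<in> {1..<int p}" "y = rank_one u' v' c'"
    using assms(2) by (rule zero_divisorE)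
  show ?thesis
    unfolding x(4) y(4) rank_one_mult_eq_zero_iff[OF x(1-3) y(1-3)]
      zero_divisor_type_rank_one[OF x(1-3)] zero_divisor_type_rank_one[OF y(1-3)]
    by (simp add: ray_eq_iff perp_in_proj_points prime x y)
qed

text \<open>
  Kernel and image determine \<open>v\<close> and \<open>u\<close>, so only the \<open>p - 1\<close> scalars \<open>c\<close> are free.
\<close>

lemma card_zero_divisor_type_fibre:
  assumes "t \<in> lines p \<times> lines p"
  shows "card {x \<in> zero_divisors R. zero_divisor_type x = t} = p - 1"
proof -
  have lines: "lines p = ray p ` proj_points p"
    using bij_betw_ray[OF prime] by (simp add: bij_betw_def)
  obtain w u where w: "w \<in> proj_points p" "u \<in> proj_points p" "t = (ray p w, ray p u)"
    using assms unfolding lines by auto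
  let ?v = "perp p w"
  have v: "?v \<in> proj_points p" "perp p ?v = w"
    using w prime by (simp_all add: perp_in_proj_points perp_perp)
  have "{x \<in> zero_divisors R. zero_divisor_type x = t} = rank_one u ?v ` {1..<int p}"
  proof (intro equalityI subsetI)
    fix x assume x: "x \<in> {x \<in> zero_divisors R. zero_divisor_type x = t}"
    then have "x \<in> zero_divisors R" by simp
    then obtain u' v' c where uvc: "u' \<in> proj_points p" "v' \<in> proj_points p" "c \<in> {1..<int p}" "x = rank_one u' v' c"
      by (rule zero_divisorE)
    then have "ray p (perp p v') = ray p w" "ray p u' = ray p u"
      using x w(3) by (simp_all add: zero_divisor_type_rank_one)
    then have "perp p v' = w" "u' = u"
      using uvc w prime by (simp_all add: ray_eq_iff perp_in_proj_points)
    then show "x \<in> rank_one u ?v ` {1..<int p}"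
      using uvc perp_perp[OF prime uvc(2)] by auto
  next
    fix x assume "x \<in> rank_one u ?v ` {1..<int p}"
    then show "x \<in> {x \<in> zero_divisors R. zero_divisor_type x = t}"
      using w v unfolding zero_divisors_eq by (auto simp: zero_divisor_type_rank_one image_iff intro!: bexI)
  qed
  moreover have "inj_on (rank_one u ?v) {1..<int p}"
    using rank_one_inj[OF w(2) v(1) _ w(2) v(1)] by (auto intro!: inj_onI)
  ultimately show ?thesis
    using pos by (simp add: card_image)
qed

end

text \<open>
  All that the adjacency matrix needs to know about the ring: \<open>x y = 0\<close> holds iff the image of \<open>y\<close> is the
  kernel of \<open>x\<close>, and every pair of lines is the kernel and image of \<open>p - 1\<close> zero divisors.
\<close>

lemma zero_divisor_types:
  assumes "prime p" and "odd p"
  obtains type where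
    "\<And>x. x \<in> zero_divisors (lipschitz_ring p) \<Longrightarrow> type x \<in> lines p \<times> lines p"
    "\<And>t. t \<in> lines p \<times> lines p \<Longrightarrow> card {x \<in> zero_divisors (lipschitz_ring p). type x = t} = p - 1"
    "\<And>x y. x \<in> zero_divisors (lipschitz_ring p) \<Longrightarrow> y \<in> zero_divisors (lipschitz_ring p) \<Longrightarrow>
      x \<otimes>\<^bsub>lipschitz_ring p\<^esub> y = \<zero>\<^bsub>lipschitz_ring p\<^esub> \<longleftrightarrow> snd (type y) = fst (type x)"
proof -
  obtain a b where ab: "int p dvd a * a + b * b + 1"
    using sum_two_squares_minus_one_mod_prime[OF assms] .
  have "int p dvd 2 * ((int p + 1) div 2) - 1"
    using \<open>odd p\<close> by (auto elim!: oddE)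
  with ab assms interpret lipschitz_splitting p a b "(int p + 1) div 2"
    by unfold_locales
  show thesis
    using that zero_divisor_type_in_lines card_zero_divisor_type_fibre mult_eq_zero_iff_type by blast
qed

section \<open>The spectra\<close>

lemma proots_linear_power: "proots ([:a, 1:] ^ n) = replicate_mset n (- a :: 'a :: idom)"
  by (simp add: proots_power repeat_mset_replicate_mset)
lemma proots_mult_linear_power:
  fixes f :: "'a :: idom poly"
  assumes "f \<noteq> 0"
  shows "proots (f * [:a, 1:] ^ n) = proots f + replicate_mset n (- a)"
  using assms by (simp add: proots_mult proots_linear_power)

theorem theorem4p3:
  fixes p :: nat
    and vs :: "(int \<times> int \<times> int \<times> int) list"
    and ts :: "((int \<times> int) set \<times> (int \<times> int) set) list"
  assumes "prime p" and "odd p"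
    and "distinct vs" and "set vs = pverts (zero_divisor_graph (lipschitz_ring p))"
    and "distinct ts" and "set ts = lines p \<times> lines p"
  shows "spectrum_mset (B_mat p ts) =
      {#lambda_plus p, lambda_minus p#}
      + replicate_mset p (mu_plus p)
      + replicate_mset p (mu_minus p)
      + replicate_mset p (- (real p * (real p - 1)))
      + replicate_mset (p * (p - 1) div 2) (real p - 1)
      + replicate_mset ((p + 1) * (p - 2) div 2) (- (real p - 1))
    \<and> char_poly (B_mat p ts) =
      [:- lambda_plus p, 1:] * [:- lambda_minus p, 1:]
      * [:- mu_plus p, 1:] ^ p * [:- mu_minus p, 1:] ^ p
      * [:real p * (real p - 1), 1:] ^ p
      * [:- (real p - 1), 1:] ^ (p * (p - 1) div 2)
      * [:real p - 1, 1:] ^ ((p + 1) * (p - 2) div 2)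
    \<and> char_poly (adjacency_mat (zero_divisor_graph (lipschitz_ring p)) vs) =
      [:0, 1:] ^ (p * (p + 1) * (p - 2)) * [:1, 1:] ^ ((p + 1) * (p - 2))
      * char_poly (B_mat p ts)
    \<and> spectrum_mset (adjacency_mat (zero_divisor_graph (lipschitz_ring p)) vs) =
      replicate_mset (p * (p + 1) * (p - 2)) 0
      + replicate_mset ((p + 1) * (p - 2)) (- 1)
      + {#lambda_plus p, lambda_minus p#}
      + replicate_mset p (mu_plus p)
      + replicate_mset p (mu_minus p)
      + replicate_mset p (- (real p * (real p - 1)))
      + replicate_mset (p * (p - 1) div 2) (real p - 1)
      + replicate_mset ((p + 1) * (p - 2) div 2) (- (real p - 1))"
proof -
  let ?G = "zero_divisor_graph (lipschitz_ring p)"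
  define S :: "real multiset" where "S = {#lambda_plus p, lambda_minus p#}
      + replicate_mset p (mu_plus p)
      + replicate_mset p (mu_minus p)
      + replicate_mset p (- (real p * (real p - 1)))
      + replicate_mset (p * (p - 1) div 2) (real p - 1)
      + replicate_mset ((p + 1) * (p - 2) div 2) (- (real p - 1))"
  have p2: "p \<ge> 2"
    using assms(1) by (rule prime_ge_2_nat)
  note card = card_lines[OF assms(1)]
  have vs: "set vs = zero_divisors (lipschitz_ring p)"
    using assms(4) by (simp add: zero_divisor_graph_def)
  obtain type where type: "\<And>x. x \<in> set vs \<Longrightarrow> type x \<in> lines p \<times> lines p"
    and fibre: "\<And>t. t \<in> lines p \<times> lines p \<Longrightarrow> card {x \<in> set vs. type x = t} = p - 1"
    and mult: "\<And>x y. x \<in> set vs \<Longrightarrow> y \<in> set vs \<Longrightarrow>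
      x \<otimes>\<^bsub>lipschitz_ring p\<^esub> y = \<zero>\<^bsub>lipschitz_ring p\<^esub> \<longleftrightarrow> snd (type y) = fst (type x)"
    by (rule zero_divisor_types[OF assms(1,2), folded vs], rule that) blast+
  have B: "char_poly (B_mat p ts) =
      [:- lambda_plus p, 1:] * [:- lambda_minus p, 1:]
      * [:- mu_plus p, 1:] ^ p * [:- mu_minus p, 1:] ^ p
      * [:real p * (real p - 1), 1:] ^ p
      * [:- (real p - 1), 1:] ^ (p * (p - 1) div 2)
      * [:real p - 1, 1:] ^ ((p + 1) * (p - 2) div 2)"
    by (rule char_poly_B_mat[OF p2 assms(5,6) card])
  have "adjacency_mat ?G vs = indexed_mat vs (\<lambda>x y. if x \<noteq> y \<and>
      (snd (type x) = fst (type y) \<or> snd (type y) = fst (type x)) then 1 else 0)"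
    unfolding adjacency_mat_def zero_divisor_graph_def
    by (rule indexed_mat_cong) (auto simp: mult vs[symmetric])
  then have A: "char_poly (adjacency_mat ?G vs) =
      [:0, 1:] ^ (p * (p + 1) * (p - 2)) * [:1, 1:] ^ ((p + 1) * (p - 2)) * char_poly (B_mat p ts)"
    using char_poly_composability_blow_up[OF p2 assms(3,5,6) card type fibre] by simp
  have linear_nz: "[:c, 1:] ^ n \<noteq> 0" "[:c, 1:] \<noteq> 0" for c :: real and n
    by simp_all
  have proots_two_linear: "proots ([:- x, 1:] * [:- y, 1:]) = {#x, y#}" for x y :: real
    by (subst proots_mult) (rule linear_nz, rule linear_nz, simp)
  have nz: "char_poly (B_mat p ts) \<noteq> 0"
    unfolding B by (intro no_zero_divisors linear_nz)
  have SB: "proots (char_poly (B_mat p ts)) = S"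
    unfolding B S_def
    by (subst proots_mult_linear_power, (intro no_zero_divisors linear_nz)+)+
      (simp only: proots_two_linear minus_minus)
  have SA: "proots (char_poly (adjacency_mat ?G vs)) =
      replicate_mset (p * (p + 1) * (p - 2)) 0 + replicate_mset ((p + 1) * (p - 2)) (- 1) + S"
    unfolding A SB[symmetric]
    by (subst proots_mult, (intro no_zero_divisors linear_nz nz)+)+
      (simp only: proots_linear_power minus_zero)
  show ?thesis
    unfolding spectrum_mset_def SB SA unfolding S_def using A B by (simp only: union_assoc)
qed

end
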